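(* Let $G$ be a finite group and $\alpha\in Z^3(G,k^* )$ a normalised 3-cocycle. An etale algebra in $\mathcal{Z}(G,\alpha)$ has the form $A(H,F,\gamma,\varepsilon)$, where $H\subset G$ is a subgroup, $F\unlhd H$ is a normal subgroup, $\gamma\in C^2(F,k^* )$ satisfies $d(\gamma)=\alpha|_F$, and $\varepsilon:H\times F\to k^*$ satisfies $$\varepsilon_{gh}(f)=\varepsilon_g(hfh^{-1})\varepsilon_h(f)\alpha(g,h|f)\quad (g,h\in H,\ f\in F),$$ $$\gamma(f,g)\varepsilon_h(fg)=\alpha(h|f,g)\varepsilon_h(f)\varepsilon_h(g)\gamma(hfh^{-1},hgh^{-1})\quad (h\in H,\ f,g\in F),$$ $$\gamma(f,g)=\varepsilon_f(g)\gamma(fgf^{-1},f)\quad (f,g\in F).$$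
   Context: $k$ is an algebraically closed field of characteristic zero, $k^*$ its multiplicative group; vector spaces are finite dimensional. Normalised 3-cocycles of $G$ are functions $\alpha:G^3\to k^*$ with $\alpha(g,h,l)\alpha(f,gh,l)\alpha(f,g,h)=\alpha(fg,h,l)\alpha(f,g,hl)$ and $\alpha(f,g,h)=1$ whenever one of $f,g,h$ is the identity $e$. With ${}^{g}h=ghg^{-1}$ put $$\alpha(f,g|h)=\alpha(f,g,h)^{-1}\alpha(f,{}^{g}h,g)\alpha({}^{fg}h,f,g)^{-1},\qquad \alpha(f|g,h)=\alpha(f,g,h)\alpha({}^{f}g,f,h)^{-1}\alpha({}^{f}g,{}^{f}h,f).$$ The braided monoidal category $\mathcal{Z}(G,\alpha)$ (and likewise $\mathcal{Z}(H,\alpha|_H)$): objects are $G$-graded vector spaces $X=\bigoplus_gX_g$ with an $\alpha$-projective $G$-action, i.e. automorphisms $v\mapsto f.v$ with $f.X_g=X_{fgf^{-1}}$ and $(fg).v=\alpha(f,g|h)\,f.(g.v)$ for $v\in X_h$; morphisms preserve grading and action. Tensor product: graded tensor product with $f.(x\otimes y)=\alpha(f|g,h)(f.x\otimes f.y)$ for $x\in X_g,y\in Y_h$; associativity constraint $u\otimes(v\otimes w)\mapsto\alpha(f,g,h)(u\otimes v)\otimes w$ for degrees $f,g,h$; unit $k$ in degree $e$; braiding $c_{X,Y}(x\otimes y)=f.y\otimes x$ for $x\in X_f$. "Algebra" means associative unital algebra object; $A$ is commutative if $\mu=\mu\circ c_{A,A}$; indecomposable means not a direct sum of two nonzero algebras.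 The canonical trace function $\tau:A\to k$ is zero on $A_f$ for $f\neq e$ and equals the trace of $x\mapsto ax$ on $A$ for $a\in A_e$; $A$ is separable if $a\otimes b\mapsto\tau(ab)$ is nondegenerate. Etale means indecomposable, commutative and separable. $C^2(F,k^* )$: normalised 2-cochains $F\times F\to k^*$; $d(\gamma)(f,g,h)=\gamma(g,h)\gamma(fg,h)^{-1}\gamma(f,gh)\gamma(f,g)^{-1}$. $k[F,\gamma,\varepsilon]$ is the algebra in $\mathcal{Z}(H,\alpha|_H)$ with basis $e_f$, $f\in F$, of degree $f$, multiplication $e_fe_g=\gamma(f,g)e_{fg}$ and $H$-action $h.e_f=\varepsilon_h(f)e_{hfh^{-1}}$. For $V\in\mathcal{Z}(H,\alpha|_H)$ (viewed as $G$-graded with zero components outside $H$) let $E(V)=\bigoplus_{f\in G}E(V)_f\in\mathcal{Z}(G,\alpha)$, where $E(V)_f$ is the space of maps $a:G\to V$ with $a(x)\in V_{x^{-1}fx}$ and $a(xh)=\alpha(h^{-1},x^{-1}|f)\,h^{-1}.a(x)$ for all $x\in G,h\in H$, with $G$-action $(g.a)(x)=\alpha(x^{-1},g|f)^{-1}a(g^{-1}x)$ for $a\in E(V)_f$. If $B$ is an algebra in $\mathcal{Z}(H,\alpha|_H)$, then $E(B)$ is an algebra in $\mathcal{Z}(G,\alpha)$ with $(ab)(x)=\alpha(x^{-1}|f,g)\,a(x)b(x)$ for $a\in E(B)_f,b\in E(B)_g$. Define $A(H,F,\gamma,\varepsilon)=E(k[F,\gamma,\varepsilon])$. "Has the form"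 means "is isomorphic to". *)

theory Defs
  imports
    "HOL-Algebra.Coset"
    "HOL-Computational_Algebra.Polynomial"
    "HOL-Library.Function_Algebras"
    "HOL-Library.Product_Plus"
begin

section \<open>Cocycles\<close>

text \<open>Elements of the multiplicative group of the field are rendered as nonzero field elements, and
  cochains as total functions whose values matter only on the carrier of the group.\<close>

definition conjg :: "('g, 'b) monoid_scheme \<Rightarrow> 'g \<Rightarrow> 'g \<Rightarrow> 'g" where
  "conjg G g h = g \<otimes>\<^bsub>G\<^esub> h \<otimes>\<^bsub>G\<^esub> inv\<^bsub>G\<^esub> g"

definition normalised_cocycle3 ::
    "('g, 'b) monoid_scheme \<Rightarrow> ('g \<Rightarrow> 'g \<Rightarrow> 'g \<Rightarrow> 'k::field) \<Rightarrow> bool" where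
  "normalised_cocycle3 G \<alpha> \<longleftrightarrow>
     (\<forall>f\<in>carrier G. \<forall>g\<in>carrier G. \<forall>h\<in>carrier G. \<alpha> f g h \<noteq> 0) \<and>
     (\<forall>f\<in>carrier G. \<forall>g\<in>carrier G. \<forall>h\<in>carrier G. \<forall>l\<in>carrier G.
        \<alpha> g h l * \<alpha> f (g \<otimes>\<^bsub>G\<^esub> h) l * \<alpha> f g h = \<alpha> (f \<otimes>\<^bsub>G\<^esub> g) h l * \<alpha> f g (h \<otimes>\<^bsub>G\<^esub> l)) \<and>
     (\<forall>f\<in>carrier G. \<forall>g\<in>carrier G. \<forall>h\<in>carrier G.
        f = \<one>\<^bsub>G\<^esub> \<or> g = \<one>\<^bsub>G\<^esub> \<or> h = \<one>\<^bsub>G\<^esub> \<longrightarrow> \<alpha> f g h = 1)"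

text \<open>\<open>cocycle_act G \<alpha> f g h\<close> is $\alpha(f,g|h)$ and \<open>cocycle_tensor G \<alpha> f g h\<close> is $\alpha(f|g,h)$.\<close>

definition cocycle_act ::
    "('g, 'b) monoid_scheme \<Rightarrow> ('g \<Rightarrow> 'g \<Rightarrow> 'g \<Rightarrow> 'k::field) \<Rightarrow> 'g \<Rightarrow> 'g \<Rightarrow> 'g \<Rightarrow> 'k" where
  "cocycle_act G \<alpha> f g h =
     inverse (\<alpha> f g h) * \<alpha> f (conjg G g h) g * inverse (\<alpha> (conjg G (f \<otimes>\<^bsub>G\<^esub> g) h) f g)"

definition cocycle_tensor ::
    "('g, 'b) monoid_scheme \<Rightarrow> ('g \<Rightarrow> 'g \<Rightarrow> 'g \<Rightarrow> 'k::field) \<Rightarrow> 'g \<Rightarrow> 'g \<Rightarrow> 'g \<Rightarrow> 'k" where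
  "cocycle_tensor G \<alpha> f g h =
     \<alpha> f g h * inverse (\<alpha> (conjg G f g) f h) * \<alpha> (conjg G f g) (conjg G f h) f"

definition normalised_cochain2 ::
    "('g, 'b) monoid_scheme \<Rightarrow> 'g set \<Rightarrow> ('g \<Rightarrow> 'g \<Rightarrow> 'k::field) \<Rightarrow> bool" where
  "normalised_cochain2 G F \<gamma> \<longleftrightarrow>
     (\<forall>f\<in>F. \<forall>g\<in>F. \<gamma> f g \<noteq> 0) \<and>
     (\<forall>f\<in>F. \<forall>g\<in>F. f = \<one>\<^bsub>G\<^esub> \<or> g = \<one>\<^bsub>G\<^esub> \<longrightarrow> \<gamma> f g = 1)"

definition coboundary2 ::
    "('g, 'b) monoid_scheme \<Rightarrow> ('g \<Rightarrow> 'g \<Rightarrow> 'k::field) \<Rightarrow> 'g \<Rightarrow> 'g \<Rightarrow> 'g \<Rightarrow> 'k" where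
  "coboundary2 G \<gamma> f g h =
     \<gamma> g h * inverse (\<gamma> (f \<otimes>\<^bsub>G\<^esub> g) h) * \<gamma> f (g \<otimes>\<^bsub>G\<^esub> h) * inverse (\<gamma> f g)"

section \<open>The category \<open>\<Z>(G, \<alpha>)\<close>\<close>

text \<open>A graded space is a family of subspaces of an ambient vector space on the type \<open>'v\<close>.  Its
  underlying vector space is their (direct) sum, which need not be the whole type.\<close>

record ('k, 'g, 'v) graded_rep =
  gscale :: "'k \<Rightarrow> 'v \<Rightarrow> 'v"
  gcomp :: "'g \<Rightarrow> 'v set"
  gact :: "'g \<Rightarrow> 'v \<Rightarrow> 'v"

definition gspace :: "('k::field, 'g, 'v::ab_group_add, 'r) graded_rep_scheme \<Rightarrow> 'v set" where
  "gspace X = module.span (gscale X) (\<Union>g. gcomp X g)"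

definition glinear ::
    "('k::field, 'g, 'v::ab_group_add, 'r) graded_rep_scheme \<Rightarrow>
     ('k, 'g, 'w::ab_group_add, 's) graded_rep_scheme \<Rightarrow> ('v \<Rightarrow> 'w) \<Rightarrow> bool" where
  "glinear X Y \<phi> \<longleftrightarrow>
     (\<forall>v\<in>gspace X. \<phi> v \<in> gspace Y) \<and>
     (\<forall>v\<in>gspace X. \<forall>w\<in>gspace X. \<phi> (v + w) = \<phi> v + \<phi> w) \<and>
     (\<forall>c. \<forall>v\<in>gspace X. \<phi> (gscale X c v) = gscale Y c (\<phi> v))"

text \<open>The group is meant to be finite.  Components outside its carrier are zero, so that for a
  subgroup \<open>H\<close> an object over \<open>G\<lparr>carrier := H\<rparr>\<close> is literally also \<open>G\<close>-graded.\<close>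

definition zobject ::
    "('g, 'b) monoid_scheme \<Rightarrow> ('g \<Rightarrow> 'g \<Rightarrow> 'g \<Rightarrow> 'k::field) \<Rightarrow>
     ('k, 'g, 'v::ab_group_add, 'r) graded_rep_scheme \<Rightarrow> bool" where
  "zobject G \<alpha> X \<longleftrightarrow>
     vector_space (gscale X) \<and>
     (\<forall>g\<in>carrier G. module.subspace (gscale X) (gcomp X g)) \<and>
     (\<forall>g. g \<notin> carrier G \<longrightarrow> gcomp X g = {0}) \<and>
     (\<forall>c. (\<forall>g\<in>carrier G. c g \<in> gcomp X g) \<and> (\<Sum>g\<in>carrier G. c g) = 0 \<longrightarrow>
        (\<forall>g\<in>carrier G. c g = 0)) \<and>
     (\<exists>B. finite B \<and> module.span (gscale X) B = gspace X) \<and>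
     (\<forall>f\<in>carrier G. glinear X X (gact X f) \<and> bij_betw (gact X f) (gspace X) (gspace X)) \<and>
     (\<forall>f\<in>carrier G. \<forall>g\<in>carrier G. gact X f ` gcomp X g = gcomp X (conjg G f g)) \<and>
     (\<forall>f\<in>carrier G. \<forall>g\<in>carrier G. \<forall>h\<in>carrier G. \<forall>v\<in>gcomp X h.
        gact X (f \<otimes>\<^bsub>G\<^esub> g) v = gscale X (cocycle_act G \<alpha> f g h) (gact X f (gact X g v)))"

definition zmorphism ::
    "('g, 'b) monoid_scheme \<Rightarrow> ('k::field, 'g, 'v::ab_group_add, 'r) graded_rep_scheme \<Rightarrow>
     ('k, 'g, 'w::ab_group_add, 's) graded_rep_scheme \<Rightarrow> ('v \<Rightarrow> 'w) \<Rightarrow> bool" where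
  "zmorphism G X Y \<phi> \<longleftrightarrow>
     glinear X Y \<phi> \<and>
     (\<forall>g\<in>carrier G. \<phi> ` gcomp X g \<subseteq> gcomp Y g) \<and>
     (\<forall>f\<in>carrier G. \<forall>v\<in>gspace X. \<phi> (gact X f v) = gact Y f (\<phi> v))"

text \<open>Morphisms $X \otimes Y \to Z$, given as bilinear maps on $X \times Y$ by the universal
  property of the tensor product of vector spaces.\<close>

definition ztensor_morphism ::
    "('g, 'b) monoid_scheme \<Rightarrow> ('g \<Rightarrow> 'g \<Rightarrow> 'g \<Rightarrow> 'k::field) \<Rightarrow>
     ('k, 'g, 'u::ab_group_add, 'r) graded_rep_scheme \<Rightarrow>
     ('k, 'g, 'v::ab_group_add, 's) graded_rep_scheme \<Rightarrow>
     ('k, 'g, 'w::ab_group_add, 't) graded_rep_scheme \<Rightarrow> ('u \<Rightarrow> 'v \<Rightarrow> 'w) \<Rightarrow> bool" where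
  "ztensor_morphism G \<alpha> X Y Z \<beta> \<longleftrightarrow>
     (\<forall>x\<in>gspace X. glinear Y Z (\<lambda>y. \<beta> x y)) \<and>
     (\<forall>y\<in>gspace Y. glinear X Z (\<lambda>x. \<beta> x y)) \<and>
     (\<forall>g\<in>carrier G. \<forall>h\<in>carrier G. \<forall>x\<in>gcomp X g. \<forall>y\<in>gcomp Y h.
        \<beta> x y \<in> gcomp Z (g \<otimes>\<^bsub>G\<^esub> h)) \<and>
     (\<forall>f\<in>carrier G. \<forall>g\<in>carrier G. \<forall>h\<in>carrier G. \<forall>x\<in>gcomp X g. \<forall>y\<in>gcomp Y h.
        gact Z f (\<beta> x y) = gscale Z (cocycle_tensor G \<alpha> f g h) (\<beta> (gact X f x) (gact Y f y)))"

section \<open>Algebras in \<open>\<Z>(G, \<alpha>)\<close>\<close>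

record ('k, 'g, 'v) graded_alg = "('k, 'g, 'v) graded_rep" +
  amult :: "'v \<Rightarrow> 'v \<Rightarrow> 'v"
  aone :: "'v"

text \<open>In the associativity law, $x \otimes (y \otimes z)$ is carried by the associativity constraint
  to $\alpha(f,g,h)\,(x \otimes y) \otimes z$.  The conditions on \<open>aone A\<close> say that $1 \mapsto$ \<open>aone A\<close>
  is a morphism from the unit object and a two-sided unit.\<close>

definition zalgebra ::
    "('g, 'b) monoid_scheme \<Rightarrow> ('g \<Rightarrow> 'g \<Rightarrow> 'g \<Rightarrow> 'k::field) \<Rightarrow>
     ('k, 'g, 'v::ab_group_add) graded_alg \<Rightarrow> bool" where
  "zalgebra G \<alpha> A \<longleftrightarrow>
     zobject G \<alpha> A \<and>
     ztensor_morphism G \<alpha> A A A (amult A) \<and>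
     (\<forall>f\<in>carrier G. \<forall>g\<in>carrier G. \<forall>h\<in>carrier G.
        \<forall>x\<in>gcomp A f. \<forall>y\<in>gcomp A g. \<forall>z\<in>gcomp A h.
        amult A x (amult A y z) = gscale A (\<alpha> f g h) (amult A (amult A x y) z)) \<and>
     aone A \<in> gcomp A \<one>\<^bsub>G\<^esub> \<and>
     (\<forall>f\<in>carrier G. gact A f (aone A) = aone A) \<and>
     (\<forall>x\<in>gspace A. amult A (aone A) x = x \<and> amult A x (aone A) = x)"

definition zalg_hom ::
    "('g, 'b) monoid_scheme \<Rightarrow> ('k::field, 'g, 'v::ab_group_add) graded_alg \<Rightarrow>
     ('k, 'g, 'w::ab_group_add) graded_alg \<Rightarrow> ('v \<Rightarrow> 'w) \<Rightarrow> bool" where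
  "zalg_hom G A B \<phi> \<longleftrightarrow>
     zmorphism G A B \<phi> \<and>
     (\<forall>x\<in>gspace A. \<forall>y\<in>gspace A. \<phi> (amult A x y) = amult B (\<phi> x) (\<phi> y)) \<and>
     \<phi> (aone A) = aone B"

definition zalg_isomorphic ::
    "('g, 'b) monoid_scheme \<Rightarrow> ('k::field, 'g, 'v::ab_group_add) graded_alg \<Rightarrow>
     ('k, 'g, 'w::ab_group_add) graded_alg \<Rightarrow> bool" where
  "zalg_isomorphic G A B \<longleftrightarrow>
     (\<exists>\<phi> \<psi>. zalg_hom G A B \<phi> \<and> zalg_hom G B A \<psi> \<and>
        (\<forall>x\<in>gspace A. \<psi> (\<phi> x) = x) \<and> (\<forall>y\<in>gspace B. \<phi> (\<psi> y) = y))"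

definition zalg_sum ::
    "('k, 'g, 'v) graded_alg \<Rightarrow> ('k, 'g, 'w) graded_alg \<Rightarrow> ('k, 'g, 'v \<times> 'w) graded_alg" where
  "zalg_sum A B =
     \<lparr> gscale = (\<lambda>c (v, w). (gscale A c v, gscale B c w)),
       gcomp = (\<lambda>g. gcomp A g \<times> gcomp B g),
       gact = (\<lambda>f (v, w). (gact A f v, gact B f w)),
       amult = (\<lambda>(v, w) (v', w'). (amult A v v', amult B w w')),
       aone = (aone A, aone B) \<rparr>"

definition zalg_commutative ::
    "('g, 'b) monoid_scheme \<Rightarrow> ('k::field, 'g, 'v::ab_group_add) graded_alg \<Rightarrow> bool" where
  "zalg_commutative G A \<longleftrightarrow>
     (\<forall>f\<in>carrier G. \<forall>x\<in>gcomp A f. \<forall>y\<in>gspace A. amult A x y = amult A (gact A f y) x)"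

text \<open>The zero algebra is not indecomposable.  Requiring the summands to live on the ambient type
  of \<open>A\<close> is no restriction, since they embed into \<open>A\<close> as vector spaces.\<close>

definition zalg_indecomposable ::
    "('g, 'b) monoid_scheme \<Rightarrow> ('g \<Rightarrow> 'g \<Rightarrow> 'g \<Rightarrow> 'k::field) \<Rightarrow>
     ('k, 'g, 'v::ab_group_add) graded_alg \<Rightarrow> bool" where
  "zalg_indecomposable G \<alpha> A \<longleftrightarrow>
     gspace A \<noteq> {0} \<and>
     \<not> (\<exists>(A1 :: ('k, 'g, 'v) graded_alg) (A2 :: ('k, 'g, 'v) graded_alg).
          zalgebra G \<alpha> A1 \<and> zalgebra G \<alpha> A2 \<and> gspace A1 \<noteq> {0} \<and> gspace A2 \<noteq> {0} \<and>
          zalg_isomorphic G A (zalg_sum A1 A2))"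

text \<open>Trace of a linear endomorphism \<open>\<phi>\<close> of a finite-dimensional subspace \<open>W\<close>, computed in some
  basis of \<open>W\<close>.\<close>

definition subspace_trace ::
    "('k::field \<Rightarrow> 'v::ab_group_add \<Rightarrow> 'v) \<Rightarrow> 'v set \<Rightarrow> ('v \<Rightarrow> 'v) \<Rightarrow> 'k" where
  "subspace_trace s W \<phi> =
     (let B = (SOME B. \<not> module.dependent s B \<and> module.span s B = W)
      in \<Sum>b\<in>B. module.representation s B (\<phi> b) b)"

definition hom_part ::
    "('k::field, 'g, 'v::ab_group_add, 'r) graded_rep_scheme \<Rightarrow> 'g \<Rightarrow> 'v \<Rightarrow> 'v" where
  "hom_part X g v =
     (THE u. u \<in> gcomp X g \<and> v - u \<in> module.span (gscale X) (\<Union>h\<in>- {g}. gcomp X h))"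

definition canonical_trace ::
    "('g, 'b) monoid_scheme \<Rightarrow> ('k::field, 'g, 'v::ab_group_add) graded_alg \<Rightarrow> 'v \<Rightarrow> 'k" where
  "canonical_trace G A a =
     subspace_trace (gscale A) (gspace A) (\<lambda>x. amult A (hom_part A \<one>\<^bsub>G\<^esub> a) x)"

definition zalg_separable ::
    "('g, 'b) monoid_scheme \<Rightarrow> ('k::field, 'g, 'v::ab_group_add) graded_alg \<Rightarrow> bool" where
  "zalg_separable G A \<longleftrightarrow>
     (\<forall>a\<in>gspace A. (\<forall>b\<in>gspace A. canonical_trace G A (amult A a b) = 0) \<longrightarrow> a = 0) \<and>
     (\<forall>b\<in>gspace A. (\<forall>a\<in>gspace A. canonical_trace G A (amult A a b) = 0) \<longrightarrow> b = 0)"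

definition etale_algebra ::
    "('g, 'b) monoid_scheme \<Rightarrow> ('g \<Rightarrow> 'g \<Rightarrow> 'g \<Rightarrow> 'k::field) \<Rightarrow>
     ('k, 'g, 'v::ab_group_add) graded_alg \<Rightarrow> bool" where
  "etale_algebra G \<alpha> A \<longleftrightarrow>
     zalgebra G \<alpha> A \<and> zalg_indecomposable G \<alpha> A \<and> zalg_commutative G A \<and> zalg_separable G A"

section \<open>The algebras \<open>A(H, F, \<gamma>, \<epsilon>)\<close>\<close>

text \<open>The space with basis $e_f$, $f \in F$, consists of the functions on \<open>'g\<close> supported in \<open>F\<close>.\<close>

definition basis_elt :: "'g \<Rightarrow> 'g \<Rightarrow> 'k::field" where
  "basis_elt f = (\<lambda>x. if x = f then 1 else 0)"

definition fscale :: "'k::field \<Rightarrow> ('g \<Rightarrow> 'k) \<Rightarrow> 'g \<Rightarrow> 'k" where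
  "fscale c v = (\<lambda>x. c * v x)"

definition twisted_group_alg ::
    "('g, 'b) monoid_scheme \<Rightarrow> 'g set \<Rightarrow> ('g \<Rightarrow> 'g \<Rightarrow> 'k::field) \<Rightarrow> ('g \<Rightarrow> 'g \<Rightarrow> 'k) \<Rightarrow>
     ('k, 'g, 'g \<Rightarrow> 'k) graded_alg" where
  "twisted_group_alg G F \<gamma> \<epsilon> =
     \<lparr> gscale = fscale,
       gcomp = (\<lambda>f. if f \<in> F then range (\<lambda>c. fscale c (basis_elt f)) else {0}),
       gact = (\<lambda>h v. \<Sum>f\<in>F. fscale (v f * \<epsilon> h f) (basis_elt (conjg G h f))),
       amult = (\<lambda>v w. \<Sum>f\<in>F. \<Sum>g\<in>F. fscale (v f * w g * \<gamma> f g) (basis_elt (f \<otimes>\<^bsub>G\<^esub> g))),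
       aone = basis_elt \<one>\<^bsub>G\<^esub> \<rparr>"

text \<open>The space $E(V)_f$; its elements are extended by zero outside the carrier of \<open>G\<close>.\<close>

definition ind_comp ::
    "('g, 'b) monoid_scheme \<Rightarrow> ('g \<Rightarrow> 'g \<Rightarrow> 'g \<Rightarrow> 'k::field) \<Rightarrow> 'g set \<Rightarrow>
     ('k, 'g, 'v::ab_group_add, 'r) graded_rep_scheme \<Rightarrow> 'g \<Rightarrow> ('g \<Rightarrow> 'v) set" where
  "ind_comp G \<alpha> H V f =
     {a. (\<forall>x\<in>carrier G. a x \<in> gcomp V (inv\<^bsub>G\<^esub> x \<otimes>\<^bsub>G\<^esub> f \<otimes>\<^bsub>G\<^esub> x)) \<and>
         (\<forall>x\<in>carrier G. \<forall>h\<in>H. a (x \<otimes>\<^bsub>G\<^esub> h) =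
            gscale V (cocycle_act G \<alpha> (inv\<^bsub>G\<^esub> h) (inv\<^bsub>G\<^esub> x) f) (gact V (inv\<^bsub>G\<^esub> h) (a x))) \<and>
         (\<forall>x. x \<notin> carrier G \<longrightarrow> a x = 0)}"

text \<open>The direct sum $E(V) = \bigoplus_f E(V)_f$ is external: an element \<open>a\<close> is the family of its
  components \<open>a f\<close>.  Accordingly \<open>gact\<close> and \<open>amult\<close> below are the additive extensions of the formulas
  for homogeneous elements; the component of $g.a$ in degree \<open>f'\<close> comes from the component of \<open>a\<close>
  in degree $g^{-1} f' g$.\<close>

definition ind_rep ::
    "('g, 'b) monoid_scheme \<Rightarrow> ('g \<Rightarrow> 'g \<Rightarrow> 'g \<Rightarrow> 'k::field) \<Rightarrow> 'g set \<Rightarrow>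
     ('k, 'g, 'v::ab_group_add, 'r) graded_rep_scheme \<Rightarrow> ('k, 'g, 'g \<Rightarrow> 'g \<Rightarrow> 'v) graded_rep" where
  "ind_rep G \<alpha> H V =
     \<lparr> gscale = (\<lambda>c a f x. gscale V c (a f x)),
       gcomp = (\<lambda>f. if f \<in> carrier G
                    then {a. a f \<in> ind_comp G \<alpha> H V f \<and> (\<forall>f'. f' \<noteq> f \<longrightarrow> a f' = 0)} else {0}),
       gact = (\<lambda>g a f' x. if f' \<in> carrier G \<and> x \<in> carrier G
                 then (let f = conjg G (inv\<^bsub>G\<^esub> g) f' in
                       gscale V (inverse (cocycle_act G \<alpha> (inv\<^bsub>G\<^esub> x) g f)) (a f (inv\<^bsub>G\<^esub> g \<otimes>\<^bsub>G\<^esub> x)))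
                 else 0) \<rparr>"

definition ind_alg ::
    "('g, 'b) monoid_scheme \<Rightarrow> ('g \<Rightarrow> 'g \<Rightarrow> 'g \<Rightarrow> 'k::field) \<Rightarrow> 'g set \<Rightarrow>
     ('k, 'g, 'v::ab_group_add) graded_alg \<Rightarrow> ('k, 'g, 'g \<Rightarrow> 'g \<Rightarrow> 'v) graded_alg" where
  "ind_alg G \<alpha> H B = graded_rep.extend (ind_rep G \<alpha> H B)
     (graded_alg.fields
       (\<lambda>a b k x. if x \<in> carrier G
          then (\<Sum>(f, g) | f \<in> carrier G \<and> g \<in> carrier G \<and> f \<otimes>\<^bsub>G\<^esub> g = k.
                  gscale B (cocycle_tensor G \<alpha> (inv\<^bsub>G\<^esub> x) f g) (amult B (a f x) (b g x)))
          else 0)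
       (\<lambda>f x. if f = \<one>\<^bsub>G\<^esub> \<and> x \<in> carrier G then aone B else 0))"

definition etale_model ::
    "('g, 'b) monoid_scheme \<Rightarrow> ('g \<Rightarrow> 'g \<Rightarrow> 'g \<Rightarrow> 'k::field) \<Rightarrow> 'g set \<Rightarrow> 'g set \<Rightarrow>
     ('g \<Rightarrow> 'g \<Rightarrow> 'k) \<Rightarrow> ('g \<Rightarrow> 'g \<Rightarrow> 'k) \<Rightarrow> ('k, 'g, 'g \<Rightarrow> 'g \<Rightarrow> 'g \<Rightarrow> 'k) graded_alg" where
  "etale_model G \<alpha> H F \<gamma> \<epsilon> = ind_alg G \<alpha> H (twisted_group_alg G F \<gamma> \<epsilon>)"

end

(*
  The part A_1 of degree 1 is a commutative algebra in the ordinary sense, and it is reduced because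
  multiplication by a square-zero element has trace zero; so it is a product of copies of k, and its
  primitive idempotents are permuted by G, transitively because the sum over an orbit is an invariant
  idempotent.  Let e be one of them and H its stabiliser.  In the corner eA the product of a nonzero
  element of degree f with a suitable element of degree f^-1 is a nonzero multiple of e, so the graded
  parts are at most one-dimensional, and the degrees that occur form a normal subgroup F of H: a basis
  turns eA into k[F, gamma, epsilon].  The isomorphism from A sends a to the function
  x |-> e (x^-1.a), and a is recovered from its values since 1 is the sum of the idempotents x.e.
*)

theory Submission
  imports Defs
begin

section \<open>Linear algebra\<close>

text \<open>Since associativity holds only up to the scalars \<open>\<alpha> f g h\<close>,
  \<open>A\<close> is not a ring. But the cocycle is normalised, so the scalars caused by a factor
  of degree one are all 1: such a factor associates strictly with everything, the group acts on it
  by an honest action, and it is central because the identity acts trivially. The ring theory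
  (idempotents, corners, minimal polynomials) therefore stays in degree one; in other degrees the
  scalars are either harmless nonzero factors or exactly those that the statement names. That a
  primitive corner has only scalars in degree one rests on a root of the minimal polynomial of an
  element. That \<open>F\<close> lies in \<open>H\<close> rests on the braiding: for
  \<open>x\<close> of degree \<open>g\<close> in the corner, x e = (g.e) x, and distinct conjugates
  of e are orthogonal. The equations for \<gamma> and \<epsilon> are the algebra axioms in
  coordinates, once a vector is chosen in each degree. The scalars in E(V) are those that appear
  when x^-1 is moved past a product or past another group element. Surjectivity onto the model is
  shown without counting dimensions: a preimage is glued from its local values along the orbit of
  e.\<close>

context vector_space begin

text \<open>The ambient type may be infinite dimensional, so finiteness enters here and below
  through a finite set \<open>T\<close> whose span contains the subspace.\<close>

lemma fd_subspace_basis: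
  assumes "finite T" "subspace W" "W \<subseteq> span T"
  obtains B where "finite B" "independent B" "span B = W"
proof -
  obtain B where B: "B \<subseteq> W" "independent B" "W \<subseteq> span B"
    using basis_exists[of W] by metis
  moreover have "finite B"
    using independent_span_bound[OF assms(1) B(2)] B(1) assms(3) by blast
  moreover have "span B = W"
    using B assms(2) by (simp add: span_subspace)
  ultimately show ?thesis using that by blast
qed

lemma dim_mono_fd:
  assumes "finite T" "W \<subseteq> span T" "subspace U" "subspace W" "U \<subset> W"
  shows "dim U < dim W"
proof -
  obtain B where B: "finite B" "independent B" "span B = U"
    using fd_subspace_basis[of T U] assms by (metis psubset_imp_subset subset_trans)
  obtain C where C: "finite C" "independent C" "span C = W"
    using fd_subspace_basis[of T W] assms by metis
  obtain x where x: "x \<in> W" "x \<notin> U" using assms(5) by blast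
  have ind: "independent (insert x B)"
    using independent_insertI[of x B] x B by simp
  have "insert x B \<subseteq> span C"
    using x B C assms(5) span_superset[of B] by auto
  from independent_span_bound[OF C(1) ind this] have "card (insert x B) \<le> card C" by simp
  moreover have "card (insert x B) = Suc (card B)"
    using x B span_superset[of B] by (subst card_insert_disjoint) auto
  ultimately show ?thesis
    using dim_span_eq_card_independent[OF B(2)] dim_span_eq_card_independent[OF C(2)] B C by simp
qed

text \<open>This is tr(PQ) = tr(QP): expanding \<open>B\<close> in \<open>C\<close> turns the first
  trace into a double sum, and after exchanging the sums the inner one contracts to a diagonal
  coefficient in \<open>C\<close>. The conditions on \<open>L\<close> are restricted to
  \<open>W\<close> because the maps met later are linear only there.\<close>

lemma trace_basis_independent:
  assumes fin: "finite B" "finite C" and ind: "independent B" "independent C"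
    and sp: "span B = W" "span C = W"
    and L: "\<And>x. x \<in> W \<Longrightarrow> L x \<in> W" "\<And>x y. x \<in> W \<Longrightarrow> y \<in> W \<Longrightarrow> L (x + y) = L x + L y"
      "\<And>c x. x \<in> W \<Longrightarrow> L (scale c x) = scale c (L x)"
  shows "(\<Sum>b\<in>B. representation B (L b) b) = (\<Sum>c\<in>C. representation C (L c) c)"
proof -
  have BW: "b \<in> W" if "b \<in> B" for b using that span_superset[of B] sp by auto
  have CW: "c \<in> W" if "c \<in> C" for c using that span_superset[of C] sp by auto
  have W0: "subspace W" using sp by (metis subspace_span)
  have L0: "L 0 = 0" using L(3)[of 0 0] subspace_0[OF W0] by simp
  have Lsum: "L (\<Sum>c\<in>S. scale (r c) c) = (\<Sum>c\<in>S. scale (r c) (L c))"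
    if "finite S" "S \<subseteq> W" for S r
    using that
  proof (induction S rule: finite_induct)
    case (insert x S)
    have "(\<Sum>c\<in>S. scale (r c) c) \<in> W"
      using insert.prems by (intro subspace_sum[OF W0] subspace_scale[OF W0]) auto
    then show ?case using insert L(2)[of "scale (r x) x"] L(3) subspace_scale[OF W0] by simp
  qed (simp add: L0)
  have "(\<Sum>b\<in>B. representation B (L b) b)
      = (\<Sum>b\<in>B. \<Sum>c\<in>C. representation C b c * representation B (L c) b)"
  proof (rule sum.cong[OF refl])
    fix b assume b: "b \<in> B"
    have "L b = L (\<Sum>c\<in>C. scale (representation C b c) c)"
      using sum_representation_eq[OF ind(2), of b C] BW[OF b] sp fin by simp
    also have "\<dots> = (\<Sum>c\<in>C. scale (representation C b c) (L c))"
      using Lsum[OF fin(2)] CW by blast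
    finally have eq: "L b = (\<Sum>c\<in>C. scale (representation C b c) (L c))" .
    have "representation B (L b) b = (\<Sum>c\<in>C. representation B (scale (representation C b c) (L c)) b)"
      unfolding eq using CW L(1) sp W0
      by (subst representation_sum[OF ind(1)]) (auto intro: subspace_scale)
    also have "\<dots> = (\<Sum>c\<in>C. representation C b c * representation B (L c) b)"
      using CW L(1) sp by (intro sum.cong refl) (simp add: representation_scale[OF ind(1)])
    finally show "representation B (L b) b = (\<Sum>c\<in>C. representation C b c * representation B (L c) b)" .
  qed
  also have "\<dots> = (\<Sum>c\<in>C. \<Sum>b\<in>B. representation B (L c) b * representation C b c)"
    by (subst sum.swap) (simp add: mult.commute)
  also have "\<dots> = (\<Sum>c\<in>C. representation C (L c) c)"
  proof (rule sum.cong[OF refl])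
    fix c assume c: "c \<in> C"
    have eq: "L c = (\<Sum>b\<in>B. scale (representation B (L c) b) b)"
      using sum_representation_eq[OF ind(1), of "L c" B] CW[OF c] L(1) sp fin by simp
    have "representation C (L c) c = representation C (\<Sum>b\<in>B. scale (representation B (L c) b) b) c"
      using eq by simp
    also have "\<dots> = (\<Sum>b\<in>B. representation C (scale (representation B (L c) b) b) c)"
      using BW sp W0
      by (subst representation_sum[OF ind(2)]) (auto intro: subspace_scale)
    also have "\<dots> = (\<Sum>b\<in>B. representation B (L c) b * representation C b c)"
      using BW sp by (intro sum.cong refl) (simp add: representation_scale[OF ind(2)])
    finally show "(\<Sum>b\<in>B. representation B (L c) b * representation C b c) = representation C (L c) c"
      by simp
  qed
  finally show ?thesis .
qed

text \<open>The trace is defined with a basis picked by \<open>SOME\<close>; this frees it from the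
  choice, so that a basis adapted to the map can be used.\<close>

lemma subspace_trace_eq:
  assumes fin: "finite C" and ind: "independent C" and sp: "span C = W"
    and L: "\<And>x. x \<in> W \<Longrightarrow> L x \<in> W" "\<And>x y. x \<in> W \<Longrightarrow> y \<in> W \<Longrightarrow> L (x + y) = L x + L y"
      "\<And>c x. x \<in> W \<Longrightarrow> L (scale c x) = scale c (L x)"
  shows "subspace_trace scale W L = (\<Sum>c\<in>C. representation C (L c) c)"
proof -
  define B where "B = (SOME B. independent B \<and> span B = W)"
  have B: "independent B \<and> span B = W"
    unfolding B_def using ind sp by (rule_tac someI[of _ C]) blast
  then have "finite B"
    using independent_span_bound[OF fin, of B] sp span_superset[of B] by auto
  then show ?thesis
    using trace_basis_independent[of B C W L] B assms
    by (simp add: subspace_trace_def Let_def B_def)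
qed

text \<open>In a basis extending one of the kernel \<open>K\<close> the diagonal of \<open>L\<close>
  vanishes: \<open>L\<close> kills the part \<open>B0\<close> spanning \<open>K\<close> and sends
  the remaining vectors into \<open>K\<close>.\<close>

lemma subspace_trace_square_zero:
  assumes fin: "finite T" and W: "subspace W" "W \<subseteq> span T"
    and L: "\<And>x. x \<in> W \<Longrightarrow> L x \<in> W" "\<And>x y. x \<in> W \<Longrightarrow> y \<in> W \<Longrightarrow> L (x + y) = L x + L y"
      "\<And>c x. x \<in> W \<Longrightarrow> L (scale c x) = scale c (L x)"
    and sq: "\<And>x. x \<in> W \<Longrightarrow> L (L x) = 0"
  shows "subspace_trace scale W L = 0"
proof -
  define K where "K = {x \<in> W. L x = 0}"
  have L0: "L 0 = 0" using L(3)[of 0 0] subspace_0[OF W(1)] by simp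
  have K: "subspace K"
    unfolding K_def using W(1) L L0 by (auto simp: subspace_def)
  obtain B0 where B0: "finite B0" "independent B0" "span B0 = K"
    using fd_subspace_basis[OF fin K] W by (auto simp: K_def)
  have "B0 \<subseteq> W" using B0 span_superset[of B0] by (auto simp: K_def)
  then obtain B where B: "B0 \<subseteq> B" "B \<subseteq> W" "independent B" "W \<subseteq> span B"
    using maximal_independent_subset_extend[of B0 W] B0 by metis
  have sp: "span B = W" using B W by (simp add: span_subspace)
  have finB: "finite B" using independent_span_bound[OF fin B(3)] B W by blast
  have "representation B (L b) b = 0" if b: "b \<in> B" for b
  proof (cases "b \<in> B0")
    case True
    then have "L b = 0" using B0 span_superset[of B0] by (auto simp: K_def)
    then show ?thesis by (simp add: representation_zero)
  next
    case False
    have "L b \<in> span B0" using b B sq L(1) B0 by (auto simp: K_def)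
    then have "representation B (L b) = representation B0 (L b)"
      using representation_extend[OF B(3) _ B(1)] by simp
    then show ?thesis using representation_ne_zero[of B0 "L b" b] False by auto
  qed
  then show ?thesis using subspace_trace_eq[OF finB B(3) sp L] by simp
qed

end

section \<open>Objects and algebras in \<open>\<Z>(G, \<alpha>)\<close>\<close>

locale zalg = group G for G :: "('g, 'b) monoid_scheme" (structure) +
  fixes \<alpha> :: "'g \<Rightarrow> 'g \<Rightarrow> 'g \<Rightarrow> 'k::field"
    and A :: "('k, 'g, 'v::ab_group_add) graded_alg"
  assumes fin: "finite (carrier G)"
    and coc: "normalised_cocycle3 G \<alpha>"
    and alg: "zalgebra G \<alpha> A"
begin

abbreviation scl (infixr "\<cdot>" 75) where "c \<cdot> x \<equiv> gscale A c x"
abbreviation mul (infixl "\<star>" 70) where "x \<star> y \<equiv> amult A x y"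
abbreviation act (infixr "\<triangleright>" 75) where "f \<triangleright> x \<equiv> gact A f x"
abbreviation C where "C \<equiv> gcomp A"
abbreviation V where "V \<equiv> gspace A"
abbreviation U where "U \<equiv> aone A"
abbreviation pr where "pr \<equiv> hom_part A"
abbreviation cj where "cj \<equiv> conjg G"

lemma obj: "zobject G \<alpha> A" and ten: "ztensor_morphism G \<alpha> A A A (amult A)"
  using alg by (auto simp: zalgebra_def)

sublocale vs: vector_space "gscale A"
  using obj by (simp add: zobject_def)

section \<open>Conjugation and the normalisation of the cocycle\<close>

lemma cj_closed [simp]: "f \<in> carrier G \<Longrightarrow> g \<in> carrier G \<Longrightarrow> cj f g \<in> carrier G"
  by (simp add: conjg_def)

lemma cj_one [simp]: "f \<in> carrier G \<Longrightarrow> cj f \<one> = \<one>" "g \<in> carrier G \<Longrightarrow> cj \<one> g = g"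
  by (simp_all add: conjg_def)

lemma cj_mult: "f \<in> carrier G \<Longrightarrow> g \<in> carrier G \<Longrightarrow> h \<in> carrier G \<Longrightarrow> cj (f \<otimes> g) h = cj f (cj g h)"
  by (simp add: conjg_def inv_mult_group m_assoc)

lemma cj_inv: "f \<in> carrier G \<Longrightarrow> h \<in> carrier G \<Longrightarrow> cj (inv f) (cj f h) = h"
  "f \<in> carrier G \<Longrightarrow> h \<in> carrier G \<Longrightarrow> cj f (cj (inv f) h) = h"
  by (simp_all flip: cj_mult)

lemma cj_inv_eq: "x \<in> carrier G \<Longrightarrow> cj (inv x) f = inv x \<otimes> f \<otimes> x"
  by (simp add: conjg_def)

lemma cocycle_nz: "f \<in> carrier G \<Longrightarrow> g \<in> carrier G \<Longrightarrow> h \<in> carrier G \<Longrightarrow> \<alpha> f g h \<noteq> 0"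
  using coc by (auto simp: normalised_cocycle3_def)

lemma cocycle_norm:
  "f \<in> carrier G \<Longrightarrow> g \<in> carrier G \<Longrightarrow> h \<in> carrier G \<Longrightarrow> f = \<one> \<or> g = \<one> \<or> h = \<one> \<Longrightarrow> \<alpha> f g h = 1"
  using coc unfolding normalised_cocycle3_def by blast

lemma cocycle_one [simp]:
  "f \<in> carrier G \<Longrightarrow> g \<in> carrier G \<Longrightarrow> \<alpha> \<one> f g = 1"
  "f \<in> carrier G \<Longrightarrow> g \<in> carrier G \<Longrightarrow> \<alpha> f \<one> g = 1"
  "f \<in> carrier G \<Longrightarrow> g \<in> carrier G \<Longrightarrow> \<alpha> f g \<one> = 1"
  by (simp_all add: cocycle_norm)

lemma cocycle_act_nz:
  "f \<in> carrier G \<Longrightarrow> g \<in> carrier G \<Longrightarrow> h \<in> carrier G \<Longrightarrow> cocycle_act G \<alpha> f g h \<noteq> 0"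
  by (simp add: cocycle_act_def cocycle_nz)

lemma cocycle_act_one [simp]:
  "f \<in> carrier G \<Longrightarrow> g \<in> carrier G \<Longrightarrow> cocycle_act G \<alpha> f g \<one> = 1"
  "g \<in> carrier G \<Longrightarrow> h \<in> carrier G \<Longrightarrow> cocycle_act G \<alpha> \<one> g h = 1"
  by (simp_all add: cocycle_act_def)

lemma cocycle_tensor_one [simp]:
  "f \<in> carrier G \<Longrightarrow> g \<in> carrier G \<Longrightarrow> cocycle_tensor G \<alpha> f \<one> g = 1"
  by (simp add: cocycle_tensor_def)

section \<open>Homogeneous components and the projections onto them\<close>

lemma comp_outside: "g \<notin> carrier G \<Longrightarrow> C g = {0}"
  using obj by (simp add: zobject_def)

lemma comp_subspace: "vs.subspace (C g)"
  using obj comp_outside by (cases "g \<in> carrier G") (auto simp: zobject_def)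

lemmas comp_0 [simp] = vs.subspace_0[OF comp_subspace]
lemmas comp_add = vs.subspace_add[OF comp_subspace]
lemmas comp_diff = vs.subspace_diff[OF comp_subspace]
lemmas comp_scale = vs.subspace_scale[OF comp_subspace]
lemmas comp_sum = vs.subspace_sum[OF comp_subspace]

lemma V_subspace: "vs.subspace V"
  by (simp add: gspace_def)

lemmas V_0 [simp] = vs.subspace_0[OF V_subspace]
lemmas V_add [simp] = vs.subspace_add[OF V_subspace]
lemmas V_diff [simp] = vs.subspace_diff[OF V_subspace]
lemmas V_scale [simp] = vs.subspace_scale[OF V_subspace]
lemmas V_sum = vs.subspace_sum[OF V_subspace]

lemma comp_V: "x \<in> C g \<Longrightarrow> x \<in> V"
  unfolding gspace_def by (rule vs.span_base) blast

lemma U_comp [simp]: "U \<in> C \<one>"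
  using alg by (simp add: zalgebra_def)

lemma U_V [simp]: "U \<in> V"
  by (rule comp_V[OF U_comp])

lemma U_mul [simp]: "x \<in> V \<Longrightarrow> U \<star> x = x" "x \<in> V \<Longrightarrow> x \<star> U = x"
  using alg by (simp_all add: zalgebra_def)

lemma act_U: "f \<in> carrier G \<Longrightarrow> f \<triangleright> U = U"
  using alg by (simp add: zalgebra_def)

text \<open>Scalars need no case of their own because components are closed under scaling; degrees
  off the carrier contribute only 0, which is covered by degree one.\<close>

lemma V_induct [consumes 1, case_names comp add]:
  assumes "x \<in> V" "\<And>g x. g \<in> carrier G \<Longrightarrow> x \<in> C g \<Longrightarrow> P x"
    "\<And>x y. x \<in> V \<Longrightarrow> y \<in> V \<Longrightarrow> P x \<Longrightarrow> P y \<Longrightarrow> P (x + y)"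
  shows "P x"
proof -
  have hom: "P y" if "y \<in> C g" for g y
    using that assms(2)[of g] assms(2)[of \<one> 0] comp_outside[of g] by (cases "g \<in> carrier G") auto
  have "x \<in> V \<and> P x"
    using assms(1) unfolding gspace_def
  proof (induction rule: vs.span_induct_alt)
    case base
    show ?case using hom[of 0 \<one>] by (simp add: vs.span_zero)
  next
    case (step c x y)
    then have "c \<cdot> x \<in> V" "P (c \<cdot> x)" using hom comp_scale comp_V by blast+
    then show ?case using step assms(3)[of "c \<cdot> x" y] V_add by (auto simp: gspace_def)
  qed
  then show ?thesis by simp
qed

lemma V_decomp:
  assumes "x \<in> V"
  obtains c where "\<And>g. c g \<in> C g" "x = (\<Sum>g\<in>carrier G. c g)"
proof -
  from assms have "\<exists>c. (\<forall>g. c g \<in> C g) \<and> x = (\<Sum>g\<in>carrier G. c g)"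
  proof (induction rule: V_induct)
    case (comp g x)
    then show ?case
      by (intro exI[of _ "\<lambda>h. if h = g then x else 0"]) (simp add: sum.delta[OF fin])
  next
    case (add x y)
    then obtain c d where "\<forall>g. c g \<in> C g" "x = (\<Sum>g\<in>carrier G. c g)"
      "\<forall>g. d g \<in> C g" "y = (\<Sum>g\<in>carrier G. d g)" by metis
    then show ?case
      by (intro exI[of _ "\<lambda>g. c g + d g"]) (simp add: comp_add sum.distrib)
  qed
  then show ?thesis using that by metis
qed

lemma comp_direct:
  assumes "\<And>g. g \<in> carrier G \<Longrightarrow> c g \<in> C g" "(\<Sum>g\<in>carrier G. c g) = 0" "g \<in> carrier G"
  shows "c g = 0"
proof -
  have "\<forall>c. (\<forall>g\<in>carrier G. c g \<in> C g) \<and> (\<Sum>g\<in>carrier G. c g) = 0 \<longrightarrow> (\<forall>g\<in>carrier G. c g = 0)"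
    using obj unfolding zobject_def by (elim conjE)
  then show ?thesis using assms by metis
qed

text \<open>\<open>hom_part\<close> is a \<open>THE\<close> that refers to the span of the other
  components; this brings elements of that span into the form to which directness of the sum
  applies.\<close>

lemma span_other:
  assumes "y \<in> vs.span (\<Union>h\<in>- {g}. C h)"
  obtains d where "\<And>h. d h \<in> C h" "d g = 0" "y = (\<Sum>h\<in>carrier G. d h)"
proof -
  from assms have "\<exists>d. (\<forall>h. d h \<in> C h) \<and> d g = 0 \<and> y = (\<Sum>h\<in>carrier G. d h)"
  proof (induction rule: vs.span_induct_alt)
    case base
    show ?case by (intro exI[of _ "\<lambda>h. 0"]) simp
  next
    case (step c x y)
    then obtain h where h: "h \<noteq> g" "x \<in> C h" by blast
    obtain d where d: "\<forall>h. d h \<in> C h" "d g = 0" "y = (\<Sum>h\<in>carrier G. d h)" using step by blast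
    have *: "(\<Sum>h'\<in>carrier G. if h' = h then c \<cdot> x else 0) = c \<cdot> x"
      using comp_outside[of h] h by (auto simp: sum.delta[OF fin])
    show ?case
      using d h *
      by (intro exI[of _ "\<lambda>h'. (if h' = h then c \<cdot> x else 0) + d h'"])
        (auto simp: sum.distrib comp_scale intro!: comp_add)
  qed
  then show ?thesis using that by metis
qed

lemma pr_eq:
  assumes c: "\<And>g. g \<in> carrier G \<Longrightarrow> c g \<in> C g" and x: "x = (\<Sum>g\<in>carrier G. c g)"
    and g: "g \<in> carrier G"
  shows "pr g x = c g"
  unfolding hom_part_def
proof (rule the_equality)
  have "x - c g = (\<Sum>h\<in>carrier G - {g}. c h)"
    using x g by (simp add: sum.remove[OF fin g])
  also have "\<dots> \<in> vs.span (\<Union>h\<in>- {g}. C h)"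
    using c by (intro vs.span_sum vs.span_base) auto
  finally show "c g \<in> C g \<and> x - c g \<in> vs.span (\<Union>h\<in>- {g}. C h)" using c g by simp
next
  fix u assume u: "u \<in> C g \<and> x - u \<in> vs.span (\<Union>h\<in>- {g}. C h)"
  then obtain d where d: "\<And>h. d h \<in> C h" "d g = 0" "x - u = (\<Sum>h\<in>carrier G. d h)"
    using span_other by metis
  \<comment> \<open>Difference of two decompositions of \<open>x\<close>: the given
    \<open>c\<close>, and the one with \<open>u\<close> in degree \<open>g\<close> and
    \<open>d\<close> elsewhere. It sums to 0, so directness kills its entry at
    \<open>g\<close>.\<close>
  define e where "e = (\<lambda>h. c h - d h - (if h = g then u else 0))"
  have "(\<Sum>h\<in>carrier G. e h) = x - (x - u) - u"
    unfolding e_def sum_subtractf d(3)[symmetric] x[symmetric] using g by (simp add: sum.delta[OF fin])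
  moreover have "e h \<in> C h" if "h \<in> carrier G" for h
    using that c d u unfolding e_def by (auto intro!: comp_diff)
  ultimately have "e g = 0" using comp_direct[of e g] g by simp
  then show "u = c g" using d by (simp add: e_def)
qed

lemma pr_in: "x \<in> V \<Longrightarrow> g \<in> carrier G \<Longrightarrow> pr g x \<in> C g"
  using pr_eq V_decomp by metis

lemma sum_pr: "x \<in> V \<Longrightarrow> (\<Sum>g\<in>carrier G. pr g x) = x"
proof -
  assume "x \<in> V"
  then obtain c where c: "\<And>g. c g \<in> C g" "x = (\<Sum>g\<in>carrier G. c g)" using V_decomp by metis
  show ?thesis unfolding c(2) by (rule sum.cong[OF refl]) (use c pr_eq in blast)
qed

lemma pr_add: "x \<in> V \<Longrightarrow> y \<in> V \<Longrightarrow> g \<in> carrier G \<Longrightarrow> pr g (x + y) = pr g x + pr g y"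
  by (rule pr_eq[of "\<lambda>g. pr g x + pr g y"]) (auto simp: pr_in comp_add sum.distrib sum_pr)

lemma pr_scale: "x \<in> V \<Longrightarrow> g \<in> carrier G \<Longrightarrow> pr g (c \<cdot> x) = c \<cdot> pr g x"
  by (rule pr_eq[of "\<lambda>g. c \<cdot> pr g x"]) (auto simp: pr_in comp_scale sum_pr simp flip: vs.scale_sum_right)

lemma pr_comp: "x \<in> C h \<Longrightarrow> g \<in> carrier G \<Longrightarrow> pr g x = (if g = h then x else 0)"
  using comp_outside[of h]
  by (intro pr_eq[of "\<lambda>g. if g = h then x else 0"]) (auto simp: sum.delta[OF fin])

lemma pr_V: "x \<in> V \<Longrightarrow> g \<in> carrier G \<Longrightarrow> pr g x \<in> V"
  using pr_in comp_V by blast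

section \<open>The product\<close>

lemma mul_V [simp]: "x \<in> V \<Longrightarrow> y \<in> V \<Longrightarrow> x \<star> y \<in> V"
  using ten by (auto simp: ztensor_morphism_def glinear_def)

lemma mul_add_left: "x \<in> V \<Longrightarrow> y \<in> V \<Longrightarrow> z \<in> V \<Longrightarrow> (x + y) \<star> z = x \<star> z + y \<star> z"
  using ten by (auto simp: ztensor_morphism_def glinear_def)

lemma mul_add_right: "x \<in> V \<Longrightarrow> y \<in> V \<Longrightarrow> z \<in> V \<Longrightarrow> x \<star> (y + z) = x \<star> y + x \<star> z"
  using ten by (auto simp: ztensor_morphism_def glinear_def)

lemma mul_scale_left [simp]: "x \<in> V \<Longrightarrow> y \<in> V \<Longrightarrow> (c \<cdot> x) \<star> y = c \<cdot> (x \<star> y)"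
  using ten by (auto simp: ztensor_morphism_def glinear_def)

lemma mul_scale_right [simp]: "x \<in> V \<Longrightarrow> y \<in> V \<Longrightarrow> x \<star> (c \<cdot> y) = c \<cdot> (x \<star> y)"
  using ten by (auto simp: ztensor_morphism_def glinear_def)

lemma mul_0 [simp]: "x \<in> V \<Longrightarrow> 0 \<star> x = 0" "x \<in> V \<Longrightarrow> x \<star> 0 = 0"
  using mul_scale_left[of x x 0] mul_scale_right[of x x 0] mul_scale_left[of 0 x 0]
    mul_scale_right[of x 0 0] by simp_all

lemma mul_minus_right [simp]: "x \<in> V \<Longrightarrow> y \<in> V \<Longrightarrow> x \<star> (- y) = - (x \<star> y)"
  using mul_scale_right[of x y "- 1"] by simp

lemma mul_diff_left: "x \<in> V \<Longrightarrow> y \<in> V \<Longrightarrow> z \<in> V \<Longrightarrow> (x - y) \<star> z = x \<star> z - y \<star> z"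
  using mul_add_left[of "x - y" y z] by (simp add: algebra_simps)

lemma mul_diff_right: "x \<in> V \<Longrightarrow> y \<in> V \<Longrightarrow> z \<in> V \<Longrightarrow> x \<star> (y - z) = x \<star> y - x \<star> z"
  using mul_add_right[of x "y - z" z] by (simp add: algebra_simps)

lemma mul_sum_left:
  "finite I \<Longrightarrow> (\<And>i. i \<in> I \<Longrightarrow> f i \<in> V) \<Longrightarrow> y \<in> V \<Longrightarrow> (\<Sum>i\<in>I. f i) \<star> y = (\<Sum>i\<in>I. f i \<star> y)"
  by (induction I rule: finite_induct) (simp_all add: mul_add_left V_sum)

lemma mul_sum_right:
  "finite I \<Longrightarrow> (\<And>i. i \<in> I \<Longrightarrow> f i \<in> V) \<Longrightarrow> y \<in> V \<Longrightarrow> y \<star> (\<Sum>i\<in>I. f i) = (\<Sum>i\<in>I. y \<star> f i)"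
  by (induction I rule: finite_induct) (simp_all add: mul_add_right V_sum)

lemma mul_comp: "x \<in> C g \<Longrightarrow> y \<in> C h \<Longrightarrow> g \<in> carrier G \<Longrightarrow> h \<in> carrier G \<Longrightarrow> x \<star> y \<in> C (g \<otimes> h)"
  using ten by (auto simp: ztensor_morphism_def)

lemma mul_comp_one:
  assumes "p \<in> C \<one>" "x \<in> C g"
  shows "p \<star> x \<in> C g" "x \<star> p \<in> C g"
  using assms mul_comp[of p \<one> x g] mul_comp[of x g p \<one>] comp_outside[of g] comp_V[of p]
  by (cases "g \<in> carrier G"; simp)+

lemma mul_assoc:
  "x \<in> C f \<Longrightarrow> y \<in> C g \<Longrightarrow> z \<in> C h \<Longrightarrow> f \<in> carrier G \<Longrightarrow> g \<in> carrier G \<Longrightarrow> h \<in> carrier G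
    \<Longrightarrow> x \<star> (y \<star> z) = \<alpha> f g h \<cdot> ((x \<star> y) \<star> z)"
  using alg by (auto simp: zalgebra_def)

text \<open>The cocycle is 1 when one argument is the identity, so a factor of degree one associates
  strictly in every position; bilinearity extends this from homogeneous elements to all of
  \<open>V\<close>.\<close>

lemma assoc_one:
  assumes p: "p \<in> C \<one>" and x: "x \<in> V" and y: "y \<in> V"
  shows "p \<star> (x \<star> y) = (p \<star> x) \<star> y" "x \<star> (p \<star> y) = (x \<star> p) \<star> y" "x \<star> (y \<star> p) = (x \<star> y) \<star> p"
proof -
  note pV = comp_V[OF p]
  have "p \<star> (x \<star> y) = (p \<star> x) \<star> y \<and> x \<star> (p \<star> y) = (x \<star> p) \<star> y \<and> x \<star> (y \<star> p) = (x \<star> y) \<star> p"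
    using x
  proof (induction rule: V_induct)
    case (comp g x)
    note xg = comp
    show ?case using y
    proof (induction rule: V_induct)
      case (comp h y)
      then show ?case
        using mul_assoc[of p \<one> x g y h] mul_assoc[of x g p \<one> y h] mul_assoc[of x g y h p \<one>] xg p
        by simp
    next
      case (add y z)
      then show ?case using pV comp_V[OF xg(2)] by (simp add: mul_add_right mul_add_left)
    qed
  next
    case (add x z)
    then show ?case using pV y by (simp add: mul_add_left mul_add_right)
  qed
  then show "p \<star> (x \<star> y) = (p \<star> x) \<star> y" "x \<star> (p \<star> y) = (x \<star> p) \<star> y" "x \<star> (y \<star> p) = (x \<star> y) \<star> p"
    by blast+
qed

section \<open>The projective action\<close>

lemma act_V [simp]: "f \<in> carrier G \<Longrightarrow> x \<in> V \<Longrightarrow> f \<triangleright> x \<in> V"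
  using obj by (auto simp: zobject_def glinear_def)

lemma act_add: "f \<in> carrier G \<Longrightarrow> x \<in> V \<Longrightarrow> y \<in> V \<Longrightarrow> f \<triangleright> (x + y) = f \<triangleright> x + f \<triangleright> y"
  using obj by (auto simp: zobject_def glinear_def)

lemma act_scale: "f \<in> carrier G \<Longrightarrow> x \<in> V \<Longrightarrow> f \<triangleright> (c \<cdot> x) = c \<cdot> (f \<triangleright> x)"
  using obj by (auto simp: zobject_def glinear_def)

lemma act_0 [simp]: "f \<in> carrier G \<Longrightarrow> f \<triangleright> 0 = 0"
  using act_scale[of f 0 0] by simp

lemma act_diff: "f \<in> carrier G \<Longrightarrow> x \<in> V \<Longrightarrow> y \<in> V \<Longrightarrow> f \<triangleright> (x - y) = f \<triangleright> x - f \<triangleright> y"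
  using act_add[of f "x - y" y] by (simp add: algebra_simps)

lemma act_sum:
  "finite I \<Longrightarrow> (\<And>i. i \<in> I \<Longrightarrow> h i \<in> V) \<Longrightarrow> f \<in> carrier G \<Longrightarrow> f \<triangleright> (\<Sum>i\<in>I. h i) = (\<Sum>i\<in>I. f \<triangleright> h i)"
  by (induction I rule: finite_induct) (simp_all add: act_add V_sum)

lemma act_bij: "f \<in> carrier G \<Longrightarrow> bij_betw (gact A f) V V"
  using obj by (auto simp: zobject_def)

lemma act_inj: "f \<in> carrier G \<Longrightarrow> x \<in> V \<Longrightarrow> y \<in> V \<Longrightarrow> f \<triangleright> x = f \<triangleright> y \<longleftrightarrow> x = y"
  using act_bij[of f] by (auto simp: bij_betw_def inj_on_def)

lemma act_image: "f \<in> carrier G \<Longrightarrow> g \<in> carrier G \<Longrightarrow> gact A f ` C g = C (cj f g)"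
  using obj by (auto simp: zobject_def)

lemma act_comp: "f \<in> carrier G \<Longrightarrow> g \<in> carrier G \<Longrightarrow> x \<in> C g \<Longrightarrow> f \<triangleright> x \<in> C (cj f g)"
  using act_image by blast

lemma act_comp_one: "f \<in> carrier G \<Longrightarrow> x \<in> C \<one> \<Longrightarrow> f \<triangleright> x \<in> C \<one>"
  using act_comp[of f \<one> x] by simp

lemma act_mult:
  "f \<in> carrier G \<Longrightarrow> g \<in> carrier G \<Longrightarrow> h \<in> carrier G \<Longrightarrow> x \<in> C h \<Longrightarrow>
    (f \<otimes> g) \<triangleright> x = cocycle_act G \<alpha> f g h \<cdot> (f \<triangleright> (g \<triangleright> x))"
  using obj by (auto simp: zobject_def)

text \<open>On degree one the projective action is an honest one, which gives sense to orbits and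
  stabilisers of idempotents.\<close>

lemma act_mult_one: "f \<in> carrier G \<Longrightarrow> g \<in> carrier G \<Longrightarrow> p \<in> C \<one> \<Longrightarrow> (f \<otimes> g) \<triangleright> p = f \<triangleright> (g \<triangleright> p)"
  by (simp add: act_mult[of f g \<one>])

text \<open>\<open>zobject\<close> does not demand this. Since \<alpha>(1,1|g) = 1, acting once and
  acting twice by the identity agree, and injectivity of the action cancels one of them.\<close>

lemma one_act [simp]: "x \<in> V \<Longrightarrow> \<one> \<triangleright> x = x"
proof (induction rule: V_induct)
  case (comp g x)
  then have "\<one> \<triangleright> x = \<one> \<triangleright> (\<one> \<triangleright> x)" using act_mult[of \<one> \<one> g x] by simp
  then show ?case using act_inj[of \<one> x "\<one> \<triangleright> x"] comp_V[OF comp(2)] by simp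
qed (simp add: act_add)

lemma act_mul:
  "f \<in> carrier G \<Longrightarrow> g \<in> carrier G \<Longrightarrow> h \<in> carrier G \<Longrightarrow> x \<in> C g \<Longrightarrow> y \<in> C h \<Longrightarrow>
    f \<triangleright> (x \<star> y) = cocycle_tensor G \<alpha> f g h \<cdot> ((f \<triangleright> x) \<star> (f \<triangleright> y))"
  using ten by (auto simp: ztensor_morphism_def)

lemma act_mul_one:
  assumes f: "f \<in> carrier G" and p: "p \<in> C \<one>" and x: "x \<in> V"
  shows "f \<triangleright> (p \<star> x) = (f \<triangleright> p) \<star> (f \<triangleright> x)"
  using x
proof (induction rule: V_induct)
  case (comp g x)
  then show ?case using f p act_mul[of f \<one> g p x] by simp
next
  case (add x y)
  then show ?case using f comp_V[OF p] by (simp add: mul_add_right act_add)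
qed

lemma V_finite_span: obtains B where "finite B" "vs.span B = V"
proof -
  have "\<exists>B. finite B \<and> vs.span B = V"
    using obj unfolding zobject_def by blast
  then show ?thesis using that by blast
qed

lemma V_basis:
  assumes "vs.subspace W" "W \<subseteq> V"
  obtains B where "finite B" "vs.independent B" "vs.span B = W"
  using V_finite_span vs.fd_subspace_basis assms by metis

text \<open>A structure preserving map that is onto in each degree and has zero kernel has an
  inverse of the same kind. Of the target only the vector space axioms are required, so the algebra
  axioms of the model never have to be verified separately.\<close>

lemma zalg_isomorphicI:
  fixes B :: "('k, 'g, 'w::ab_group_add) graded_alg" and \<phi> :: "'v \<Rightarrow> 'w"
  assumes vsB: "vector_space (gscale B)"
    and add: "\<And>x y. x \<in> V \<Longrightarrow> y \<in> V \<Longrightarrow> \<phi> (x + y) = \<phi> x + \<phi> y"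
    and scale: "\<And>c x. x \<in> V \<Longrightarrow> \<phi> (c \<cdot> x) = gscale B c (\<phi> x)"
    and comp: "\<And>g. \<phi> ` C g = gcomp B g"
    and inj: "\<And>x. x \<in> V \<Longrightarrow> \<phi> x = 0 \<Longrightarrow> x = 0"
    and act: "\<And>f x. f \<in> carrier G \<Longrightarrow> x \<in> V \<Longrightarrow> \<phi> (f \<triangleright> x) = gact B f (\<phi> x)"
    and mul: "\<And>x y. x \<in> V \<Longrightarrow> y \<in> V \<Longrightarrow> \<phi> (x \<star> y) = amult B (\<phi> x) (\<phi> y)"
    and one: "\<phi> U = aone B"
  shows "zalg_isomorphic G A B"
proof -
  interpret B: vector_space "gscale B" by (rule vsB)
  have \<phi>0: "\<phi> 0 = 0" using scale[of 0 0] by simp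
  have into: "\<phi> x \<in> gspace B" if "x \<in> V" for x
    using that
  proof (induction rule: V_induct)
    case (comp g x)
    then show ?case using assms(4)[of g] unfolding gspace_def by (intro B.span_base) blast
  next
    case (add x y)
    then show ?case using assms(2) by (simp add: gspace_def B.span_add)
  qed
  have "B.subspace (\<phi> ` V)"
  proof (rule B.subspaceI)
    show "0 \<in> \<phi> ` V" using \<phi>0 V_0 by (metis imageI)
    show "x + y \<in> \<phi> ` V" if "x \<in> \<phi> ` V" "y \<in> \<phi> ` V" for x y
      using that add V_add by (metis (no_types, lifting) imageE imageI)
    show "gscale B c x \<in> \<phi> ` V" if "x \<in> \<phi> ` V" for c x
      using that scale V_scale by (metis (no_types, lifting) imageE imageI)
  qed
  moreover have "(\<Union>g. gcomp B g) \<subseteq> \<phi> ` V"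
    using comp comp_V by (metis UN_least image_mono subsetI)
  ultimately have onto: "gspace B \<subseteq> \<phi> ` V"
    unfolding gspace_def[of B] by (rule_tac B.span_minimal)
  have injV: "x = y" if "x \<in> V" "y \<in> V" "\<phi> x = \<phi> y" for x y
  proof -
    have "\<phi> x = \<phi> (x - y) + \<phi> y" using add[of "x - y" y] that by simp
    then show ?thesis using inj[of "x - y"] that by simp
  qed
  define \<psi> where "\<psi> = inv_into V \<phi>"
  have \<psi>\<phi>: "\<psi> (\<phi> x) = x" if "x \<in> V" for x
    unfolding \<psi>_def using that injV by (intro inv_into_f_f inj_onI)
  have *: "\<exists>x\<in>V. y = \<phi> x \<and> \<psi> y = x" if "y \<in> gspace B" for y
    using onto that \<psi>\<phi> by blast
  have \<psi>comp: "\<psi> ` gcomp B g \<subseteq> C g" for g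
    using comp[of g] \<psi>\<phi> comp_V by force
  have "zalg_hom G A B \<phi>"
    unfolding zalg_hom_def zmorphism_def glinear_def
    using into add scale act mul one equalityD1[OF comp] by blast
  moreover have "zalg_hom G B A \<psi>"
  proof -
    have "\<psi> v \<in> V" if "v \<in> gspace B" for v using *[OF that] by auto
    moreover have "\<psi> (v + w) = \<psi> v + \<psi> w" if "v \<in> gspace B" "w \<in> gspace B" for v w
      using *[OF that(1)] *[OF that(2)] add \<psi>\<phi> by (metis V_add)
    moreover have "\<psi> (gscale B c v) = c \<cdot> \<psi> v" if "v \<in> gspace B" for c v
      using *[OF that] scale \<psi>\<phi> by (metis V_scale)
    moreover have "\<psi> (gact B f v) = f \<triangleright> \<psi> v" if "f \<in> carrier G" "v \<in> gspace B" for f v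
      using *[OF that(2)] that(1) act \<psi>\<phi> by (metis act_V)
    moreover have "\<psi> (amult B v w) = \<psi> v \<star> \<psi> w" if "v \<in> gspace B" "w \<in> gspace B" for v w
      using *[OF that(1)] *[OF that(2)] mul \<psi>\<phi> by (metis mul_V)
    moreover have "\<psi> (aone B) = U" using one \<psi>\<phi> U_V by metis
    ultimately show ?thesis
      unfolding zalg_hom_def zmorphism_def glinear_def using \<psi>comp by blast
  qed
  moreover have "\<phi> (\<psi> y) = y" if "y \<in> gspace B" for y
    using *[OF that] by auto
  ultimately show ?thesis unfolding zalg_isomorphic_def using \<psi>\<phi> by blast
qed

end

section \<open>Invariant idempotents and the trace form\<close>

locale etale_zalg = zalg G \<alpha> A
  for G :: "('g, 'b) monoid_scheme" (structure)
    and \<alpha> :: "'g \<Rightarrow> 'g \<Rightarrow> 'g \<Rightarrow> 'k::alg_closed_field"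
    and A :: "('k, 'g, 'v::ab_group_add) graded_alg" +
  assumes etale: "etale_algebra G \<alpha> A"
begin

lemma comm: "x \<in> C f \<Longrightarrow> y \<in> V \<Longrightarrow> f \<in> carrier G \<Longrightarrow> x \<star> y = (f \<triangleright> y) \<star> x"
  using etale by (simp add: etale_algebra_def zalg_commutative_def)

text \<open>Braiding a degree-one element past anything is the plain flip, because the identity acts
  trivially; hence \<open>C \<one>\<close> is central in all of \<open>A\<close>.\<close>

lemma comm_one: "p \<in> C \<one> \<Longrightarrow> x \<in> V \<Longrightarrow> x \<star> p = p \<star> x"
  using comm[of p \<one> x] by simp

lemma one_part_comm: "x \<in> C \<one> \<Longrightarrow> y \<in> C \<one> \<Longrightarrow> x \<star> y = y \<star> x"
  using comm_one comp_V by blast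

lemma one_part_assoc: "x \<in> C \<one> \<Longrightarrow> y \<in> C \<one> \<Longrightarrow> z \<in> C \<one> \<Longrightarrow> (x \<star> y) \<star> z = x \<star> (y \<star> z)"
  using assoc_one(1) comp_V by metis

lemma one_part_lcomm: "x \<in> C \<one> \<Longrightarrow> y \<in> C \<one> \<Longrightarrow> z \<in> C \<one> \<Longrightarrow> x \<star> (y \<star> z) = y \<star> (x \<star> z)"
  using one_part_assoc one_part_comm by metis

definition idem :: "'v \<Rightarrow> bool" where
  "idem p \<longleftrightarrow> p \<in> C \<one> \<and> p \<star> p = p"

text \<open>For an idempotent \<open>p\<close> the fixed points of multiplication by \<open>p\<close> form the ideal \<open>p A\<close>.\<close>

definition cut :: "'v \<Rightarrow> ('k, 'g, 'v) graded_alg" where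
  "cut p = A\<lparr>gcomp := \<lambda>g. {x \<in> C g. p \<star> x = x}, aone := p\<rparr>"

lemma cut_simps [simp]:
  "gscale (cut p) = gscale A" "gact (cut p) = gact A" "amult (cut p) = amult A"
  "gcomp (cut p) = (\<lambda>g. {x \<in> C g. p \<star> x = x})" "aone (cut p) = p"
  by (simp_all add: cut_def)

lemma fixed_subspace:
  assumes "p \<in> V" "vs.subspace W" "W \<subseteq> V"
  shows "vs.subspace {x \<in> W. p \<star> x = x}"
  using assms vs.subspace_0[OF assms(2)] vs.subspace_add[OF assms(2)] vs.subspace_scale[OF assms(2)]
  by (intro vs.subspaceI) (auto simp: mul_add_right subset_iff)

lemma comp_subset_V: "C g \<subseteq> V"
  using comp_V by blast

text \<open>A fixed point \<open>x\<close> equals \<open>p \<star> x\<close>, and \<open>p\<close>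
  times each homogeneous part of \<open>x\<close> is again homogeneous and fixed, by p(py) =
  (pp)y.\<close>

lemma gspace_cut:
  assumes "idem p"
  shows "gspace (cut p) = {x \<in> V. p \<star> x = x}"
proof
  have p: "p \<in> C \<one>" "p \<in> V" "p \<star> p = p" using assms comp_V by (auto simp: idem_def)
  show "gspace (cut p) \<subseteq> {x \<in> V. p \<star> x = x}"
    unfolding gspace_def[of "cut p"] cut_simps
    using fixed_subspace[OF p(2) V_subspace] comp_V by (intro vs.span_minimal) auto
  have "p \<star> x \<in> gspace (cut p)" if "x \<in> V" for x
    using that
  proof (induction rule: V_induct)
    case (comp g x)
    then have "p \<star> x \<in> gcomp (cut p) g"
      using p comp_V[OF comp(2)] mul_comp_one assoc_one(1)[OF p(1,2)] by simp
    then show ?case unfolding gspace_def by (simp only: cut_simps) (rule vs.span_base, blast)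
  next
    case (add x y)
    then show ?case using p by (simp add: mul_add_right gspace_def vs.span_add)
  qed
  then show "{x \<in> V. p \<star> x = x} \<subseteq> gspace (cut p)" by force
qed

lemma zalgebra_cut:
  assumes idem: "idem p" and inv: "\<And>f. f \<in> carrier G \<Longrightarrow> f \<triangleright> p = p"
  shows "zalgebra G \<alpha> (cut p)"
proof -
  have p: "p \<in> C \<one>" "p \<in> V" "p \<star> p = p" using idem comp_V by (auto simp: idem_def)
  note gs = gspace_cut[OF idem]
  \<comment> \<open>Invariance of \<open>p\<close> gives p(f.x) = (f.p)(f.x) = f.(px), and
    \<open>f\<close> acts injectively.\<close>
  have fix_iff: "p \<star> (f \<triangleright> x) = f \<triangleright> x \<longleftrightarrow> p \<star> x = x" if "f \<in> carrier G" "x \<in> V" for f x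
    using act_mul_one[OF that(1) p(1) that(2)] act_inj[of f "p \<star> x" x] inv[of f] that p by simp
  have lin: "glinear (cut p) (cut p) (gact A f)" if "f \<in> carrier G" for f
    unfolding glinear_def gs using that by (simp add: fix_iff act_add act_scale)
  have bij: "bij_betw (gact A f) (gspace (cut p)) (gspace (cut p))" if f: "f \<in> carrier G" for f
    unfolding bij_betw_def
  proof
    show "inj_on (gact A f) (gspace (cut p))"
      unfolding gs using act_bij[OF f] by (auto simp: bij_betw_def inj_on_def)
    show "gact A f ` gspace (cut p) = gspace (cut p)"
    proof
      show "gact A f ` gspace (cut p) \<subseteq> gspace (cut p)"
        unfolding gs using fix_iff[OF f] act_V[OF f] by auto
      show "gspace (cut p) \<subseteq> gact A f ` gspace (cut p)"
        unfolding gs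
      proof safe
        fix y assume y: "y \<in> V" "p \<star> y = y"
        then obtain x where "x \<in> V" "y = f \<triangleright> x" using act_bij[OF f] by (metis bij_betw_imp_surj_on imageE)
        then show "y \<in> gact A f ` {x \<in> V. p \<star> x = x}" using y fix_iff[OF f] by blast
      qed
    qed
  qed
  have img: "gact A f ` gcomp (cut p) g = gcomp (cut p) (cj f g)"
    if "f \<in> carrier G" "g \<in> carrier G" for f g
    unfolding cut_simps
  proof
    note fg = that
    show "gact A f ` {x \<in> C g. p \<star> x = x} \<subseteq> {x \<in> C (cj f g). p \<star> x = x}"
      using that fix_iff act_comp comp_V by auto
    show "{x \<in> C (cj f g). p \<star> x = x} \<subseteq> gact A f ` {x \<in> C g. p \<star> x = x}"
    proof safe
      fix y assume y: "y \<in> C (cj f g)" "p \<star> y = y"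
      then obtain x where "x \<in> C g" "y = f \<triangleright> x" using act_image[OF fg] by blast
      then show "y \<in> gact A f ` {x \<in> C g. p \<star> x = x}"
        using y fix_iff[OF fg(1)] comp_V by auto
    qed
  qed
  have fd: "\<exists>B. finite B \<and> vs.span B = gspace (cut p)"
    using V_basis[OF fixed_subspace[OF p(2) V_subspace]] unfolding gs by (metis (no_types, lifting) mem_Collect_eq subset_iff)
  have obj': "zobject G \<alpha> (cut p)"
    unfolding zobject_def
  proof (intro conjI)
    show "vector_space (gscale (cut p))" by (simp add: vs.vector_space_axioms)
    show "\<forall>g\<in>carrier G. module.subspace (gscale (cut p)) (gcomp (cut p) g)"
      using fixed_subspace[OF p(2) comp_subspace comp_subset_V] by simp
    show "\<forall>g. g \<notin> carrier G \<longrightarrow> gcomp (cut p) g = {0}"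
      using comp_outside p by auto
    show "\<forall>c. (\<forall>g\<in>carrier G. c g \<in> gcomp (cut p) g) \<and> (\<Sum>g\<in>carrier G. c g) = 0 \<longrightarrow>
        (\<forall>g\<in>carrier G. c g = 0)"
      using comp_direct by simp
    show "\<exists>B. finite B \<and> module.span (gscale (cut p)) B = gspace (cut p)"
      using fd by simp
    show "\<forall>f\<in>carrier G. glinear (cut p) (cut p) (gact (cut p) f) \<and>
        bij_betw (gact (cut p) f) (gspace (cut p)) (gspace (cut p))"
      using lin bij by simp
    show "\<forall>f\<in>carrier G. \<forall>g\<in>carrier G. gact (cut p) f ` gcomp (cut p) g = gcomp (cut p) (conjg G f g)"
      using img by simp
    show "\<forall>f\<in>carrier G. \<forall>g\<in>carrier G. \<forall>h\<in>carrier G. \<forall>v\<in>gcomp (cut p) h.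
        gact (cut p) (f \<otimes> g) v =
        gscale (cut p) (cocycle_act G \<alpha> f g h) (gact (cut p) f (gact (cut p) g v))"
      using act_mult by simp
  qed
  have ten': "ztensor_morphism G \<alpha> (cut p) (cut p) (cut p) (amult (cut p))"
    unfolding ztensor_morphism_def glinear_def gs
    using p assoc_one(1)[OF p(1)] assoc_one(3)[OF p(1)] comp_V
    by (auto simp: mul_add_left mul_add_right mul_comp act_mul)
  show ?thesis
    unfolding zalgebra_def
  proof (intro conjI obj' ten' ballI)
    fix f g h x y z
    assume "f \<in> carrier G" "g \<in> carrier G" "h \<in> carrier G"
      and "x \<in> gcomp (cut p) f" "y \<in> gcomp (cut p) g" "z \<in> gcomp (cut p) h"
    then show "amult (cut p) x (amult (cut p) y z)
        = gscale (cut p) (\<alpha> f g h) (amult (cut p) (amult (cut p) x y) z)"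
      unfolding cut_simps by (intro mul_assoc) auto
  next
    fix x assume "x \<in> gspace (cut p)"
    then show "amult (cut p) (aone (cut p)) x = x" "amult (cut p) x (aone (cut p)) = x"
      using comm_one[OF p(1)] by (auto simp: gs)
  qed (use p inv in simp_all)
qed

lemma idem_complement:
  assumes "idem p"
  shows "idem (U - p)" "p \<star> (U - p) = 0" "(U - p) \<star> p = 0"
proof -
  have p: "p \<in> C \<one>" "p \<in> V" "p \<star> p = p" using assms comp_V by (auto simp: idem_def)
  then show "idem (U - p)" "p \<star> (U - p) = 0" "(U - p) \<star> p = 0"
    by (auto simp: idem_def mul_diff_left mul_diff_right comp_diff)
qed

text \<open>Otherwise \<open>A\<close> would be the direct sum of the algebras cut out by
  \<open>p\<close> and by \<open>U - p\<close>, contradicting indecomposability.\<close>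

lemma invariant_idem_trivial:
  assumes idem: "idem p" and inv: "\<And>f. f \<in> carrier G \<Longrightarrow> f \<triangleright> p = p"
  shows "p = 0 \<or> p = U"
proof (rule ccontr)
  assume ne: "\<not> (p = 0 \<or> p = U)"
  define q where "q = U - p"
  have p: "p \<in> C \<one>" "p \<in> V" "p \<star> p = p" using idem comp_V by (auto simp: idem_def)
  have idq: "idem q" "p \<star> q = 0" "q \<star> p = 0" using idem_complement[OF idem] by (simp_all add: q_def)
  have q: "q \<in> C \<one>" "q \<in> V" "q \<star> q = q" using idq comp_V by (auto simp: idem_def)
  have pq: "p + q = U" by (simp add: q_def)
  have invq: "f \<triangleright> q = q" if "f \<in> carrier G" for f
    using that p by (simp add: q_def act_diff act_U inv)
  have sum: "p \<star> x + q \<star> x = x" if "x \<in> V" for x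
    using mul_add_left[OF p(2) q(2) that] that by (simp add: pq)
  let ?B = "zalg_sum (cut p) (cut q)"
  have iso: "zalg_isomorphic G A ?B"
  proof (rule zalg_isomorphicI[where \<phi> = "\<lambda>x. (p \<star> x, q \<star> x)"])
    show "vector_space (gscale ?B)"
      by unfold_locales
        (auto simp: zalg_sum_def vs.scale_right_distrib vs.scale_left_distrib split: prod.splits)
    show "(\<lambda>x. (p \<star> x, q \<star> x)) ` C g = gcomp ?B g" for g
    proof
      show "(\<lambda>x. (p \<star> x, q \<star> x)) ` C g \<subseteq> gcomp ?B g"
        using p q mul_comp_one comp_V by (auto simp: zalg_sum_def assoc_one(1))
      show "gcomp ?B g \<subseteq> (\<lambda>x. (p \<star> x, q \<star> x)) ` C g"
      proof
        fix w assume "w \<in> gcomp ?B g"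
        then obtain x y where w: "w = (x, y)" "x \<in> C g" "p \<star> x = x" "y \<in> C g" "q \<star> y = y"
          by (auto simp: zalg_sum_def)
        have V: "x \<in> V" "y \<in> V" using w comp_V by auto
        have "q \<star> x = 0" using assoc_one(1)[OF q(1) p(2) V(1)] w idq V by simp
        moreover have "p \<star> y = 0" using assoc_one(1)[OF p(1) q(2) V(2)] w idq V by simp
        ultimately show "w \<in> (\<lambda>x. (p \<star> x, q \<star> x)) ` C g"
          using w V p q by (intro image_eqI[of _ _ "x + y"]) (simp_all add: mul_add_right comp_add)
      qed
    qed
    fix x assume x: "x \<in> V"
    show "x = 0" if "(p \<star> x, q \<star> x) = 0"
      using sum[OF x] that by (simp add: zero_prod_def)
    show "(p \<star> (c \<cdot> x), q \<star> (c \<cdot> x)) = gscale ?B c (p \<star> x, q \<star> x)" for c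
      using x p q by (simp add: zalg_sum_def)
    show "(p \<star> (f \<triangleright> x), q \<star> (f \<triangleright> x)) = gact ?B f (p \<star> x, q \<star> x)" if "f \<in> carrier G" for f
      using x p q that inv invq by (simp add: zalg_sum_def act_mul_one)
    fix y assume y: "y \<in> V"
    show "(p \<star> (x + y), q \<star> (x + y)) = (p \<star> x, q \<star> x) + (p \<star> y, q \<star> y)"
      using x y p q by (simp add: mul_add_right)
    \<comment> \<open>Here \<open>e\<close> stands for \<open>p\<close> or \<open>q\<close>: a
      central idempotent that associates strictly, so multiplying by it respects products.\<close>
    have "e \<star> (x \<star> y) = (e \<star> x) \<star> (e \<star> y)" if "e \<in> C \<one>" "e \<star> e = e" for e
      using that x y comp_V[OF that(1)] assoc_one[OF that(1)] comm_one[OF that(1)]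
      by (metis mul_V)
    then show "(p \<star> (x \<star> y), q \<star> (x \<star> y)) = amult ?B (p \<star> x, q \<star> x) (p \<star> y, q \<star> y)"
      using p q by (simp add: zalg_sum_def)
  next
    show "(p \<star> U, q \<star> U) = aone ?B" using p q by (simp add: zalg_sum_def)
  qed
  have algs: "zalgebra G \<alpha> (cut p)" "zalgebra G \<alpha> (cut q)"
    using zalgebra_cut idem inv idq invq by blast+
  have "p \<in> gspace (cut p)" "q \<in> gspace (cut q)"
    using gspace_cut idem idq p q by auto
  moreover have "p \<noteq> 0" "q \<noteq> 0" using ne by (auto simp: q_def)
  ultimately have "gspace (cut p) \<noteq> {0}" "gspace (cut q) \<noteq> {0}" by blast+
  then have "\<not> zalg_indecomposable G \<alpha> A"
    unfolding zalg_indecomposable_def using iso algs by blast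
  then show False using etale by (simp add: etale_algebra_def)
qed

lemma U_nz: "U \<noteq> 0"
proof
  assume "U = 0"
  then have "x = 0" if "x \<in> V" for x using U_mul(1)[OF that] that by simp
  then have "V = {0}" using V_0 by blast
  then show False using etale by (simp add: etale_algebra_def zalg_indecomposable_def)
qed

text \<open>The canonical trace sees only the degree-one part, and left multiplication by that part
  squares to zero because it associates strictly.\<close>

lemma trace_square_zero:
  assumes "a \<in> V" "pr \<one> a \<star> pr \<one> a = 0"
  shows "canonical_trace G A a = 0"
proof -
  obtain B where B: "finite B" "vs.span B = V" using V_finite_span by blast
  let ?c = "pr \<one> a"
  have c: "?c \<in> C \<one>" using pr_in assms by simp
  note cV = comp_V[OF c]
  show ?thesis
    unfolding canonical_trace_def
    using assms cV assoc_one(1)[OF c cV] B V_subspace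
    by (intro vs.subspace_trace_square_zero[of B]) (auto simp: mul_add_right)
qed

lemma trace_nondeg:
  assumes "a \<in> V" "a \<noteq> 0"
  obtains b where "b \<in> V" "canonical_trace G A (a \<star> b) \<noteq> 0"
  using assms etale unfolding etale_algebra_def zalg_separable_def by blast

text \<open>For homogeneous \<open>a\<close> the part of \<open>a \<star> b\<close> in any degree g
  is \<open>a\<close> times the part of \<open>b\<close> in degree f^-1 g.\<close>

lemma pr_mul_one:
  assumes "a \<in> C f" "f \<in> carrier G" "b \<in> V"
  shows "pr \<one> (a \<star> b) = a \<star> pr (inv f) b"
proof -
  have "pr \<one> (a \<star> b) = a \<star> pr (inv f \<otimes> \<one>) b"
  proof (rule pr_eq)
    show "a \<star> pr (inv f \<otimes> g) b \<in> C g" if "g \<in> carrier G" for g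
      using mul_comp[OF assms(1) pr_in[OF assms(3)] assms(2), of "inv f \<otimes> g"] that assms
      by (simp flip: m_assoc)
    have "a \<star> b = (\<Sum>g\<in>carrier G. a \<star> pr g b)"
      using mul_sum_right[OF fin, of "\<lambda>g. pr g b" a] pr_V assms sum_pr comp_V by simp
    also have "\<dots> = (\<Sum>g\<in>carrier G. a \<star> pr (inv f \<otimes> g) b)"
      using assms
      by (intro sum.reindex_bij_witness[of _ "\<lambda>g. inv f \<otimes> g" "\<lambda>g. f \<otimes> g"]) (auto simp flip: m_assoc)
    finally show "a \<star> b = (\<Sum>g\<in>carrier G. a \<star> pr (inv f \<otimes> g) b)" .
  qed simp
  then show ?thesis using assms by simp
qed

text \<open>Take \<open>b\<close> pairing nontrivially with \<open>a\<close> under the trace form.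
  The part of \<open>a \<star> b\<close> in degree one cannot vanish, and it involves only the part
  of \<open>b\<close> in degree f^-1.\<close>

lemma homogeneous_nondeg:
  assumes a: "a \<in> C f" "f \<in> carrier G" "a \<noteq> 0"
  obtains b where "b \<in> C (inv f)" "a \<star> b \<noteq> 0"
proof -
  obtain b where b: "b \<in> V" "canonical_trace G A (a \<star> b) \<noteq> 0"
    using trace_nondeg a comp_V by blast
  then have "pr \<one> (a \<star> b) \<noteq> 0"
    using trace_square_zero[of "a \<star> b"] comp_V[OF a(1)] by auto
  then show ?thesis using that[of "pr (inv f) b"] pr_mul_one a b pr_in by simp
qed

text \<open>With b' the degree-one part of \<open>b\<close>, commutativity gives (a b')^2 = a^2 b'^2
  = 0. So \<open>a\<close> is orthogonal to everything under the trace form.\<close>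

lemma reduced:
  assumes a: "a \<in> C \<one>" "a \<star> a = 0"
  shows "a = 0"
proof (rule ccontr)
  assume "a \<noteq> 0"
  then obtain b where b: "b \<in> V" "canonical_trace G A (a \<star> b) \<noteq> 0"
    using trace_nondeg a comp_V by blast
  let ?b = "pr \<one> b"
  have b1: "?b \<in> C \<one>" using pr_in b by simp
  have "pr \<one> (a \<star> b) = a \<star> ?b" using pr_mul_one[of a \<one> b] a b by simp
  moreover have "(a \<star> ?b) \<star> (a \<star> ?b) = (a \<star> a) \<star> (?b \<star> ?b)"
    using a(1) b1 mul_comp_one by (simp add: one_part_assoc one_part_lcomm[of "pr \<one> b" a])
  ultimately have "canonical_trace G A (a \<star> b) = 0"
    using trace_square_zero[of "a \<star> b"] a b b1 comp_V by simp
  then show False using b by simp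
qed

end

section \<open>Primitive idempotents\<close>

context etale_zalg begin

definition primitive :: "'v \<Rightarrow> bool" where
  "primitive e \<longleftrightarrow> idem e \<and> e \<noteq> 0 \<and> (\<forall>q. idem q \<and> q \<noteq> 0 \<and> q \<star> e = q \<longrightarrow> q = e)"

definition corner :: "'v \<Rightarrow> 'v set" where
  "corner e = {x \<in> C \<one>. e \<star> x = x}"

lemma idemD: "idem p \<Longrightarrow> p \<in> C \<one>" "idem p \<Longrightarrow> p \<in> V" "idem p \<Longrightarrow> p \<star> p = p"
  using comp_V by (auto simp: idem_def)

lemma corner_subspace: "idem e \<Longrightarrow> vs.subspace (corner e)"
  unfolding corner_def using fixed_subspace comp_subspace comp_subset_V idemD by blast

lemma corner_mul: "idem e \<Longrightarrow> x \<in> corner e \<Longrightarrow> y \<in> corner e \<Longrightarrow> x \<star> y \<in> corner e"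
  unfolding corner_def using idemD(1)[of e] by (auto simp: mul_comp_one simp flip: one_part_assoc)

text \<open>A nonzero idempotent whose corner has least dimension is primitive: a different nonzero
  idempotent \<open>q\<close> below \<open>e\<close> has a strictly smaller corner, since
  \<open>e\<close> itself is missing from it.\<close>

lemma primitive_exists: "\<exists>e. primitive e"
proof -
  have "idem U \<and> U \<noteq> 0" using U_nz by (simp add: idem_def)
  then obtain e where e: "idem e" "e \<noteq> 0"
    and min: "\<And>q. idem q \<Longrightarrow> q \<noteq> 0 \<Longrightarrow> vs.dim (corner e) \<le> vs.dim (corner q)"
    using ex_has_least_nat[of "\<lambda>e. idem e \<and> e \<noteq> 0" U "\<lambda>e. vs.dim (corner e)"] by blast
  have "q = e" if q: "idem q" "q \<noteq> 0" "q \<star> e = q" for q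
  proof (rule ccontr)
    assume "q \<noteq> e"
    have "corner q \<subseteq> corner e"
    proof
      fix x assume "x \<in> corner q"
      then have x: "x \<in> C \<one>" "q \<star> x = x" by (auto simp: corner_def)
      have "e \<star> x = e \<star> (q \<star> x)" by (simp add: x)
      also have "\<dots> = (q \<star> e) \<star> x"
        using x idemD(1)[OF e(1)] idemD(1)[OF q(1)] by (metis one_part_assoc one_part_comm)
      finally show "x \<in> corner e" using x q by (simp add: corner_def)
    qed
    moreover have "e \<in> corner e" using idemD[OF e(1)] by (simp add: corner_def)
    moreover have "e \<notin> corner q" using q \<open>q \<noteq> e\<close> by (auto simp: corner_def)
    ultimately have sub: "corner q \<subset> corner e" by blast
    obtain B where "finite B" "vs.span B = V" using V_finite_span by blast
    then have "vs.dim (corner q) < vs.dim (corner e)"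
      using vs.dim_mono_fd[of B "corner e" "corner q"] sub corner_subspace q e comp_V
      by (auto simp: corner_def)
    then show False using min[OF q(1,2)] by simp
  qed
  then show ?thesis using e by (auto simp: primitive_def)
qed

text \<open>Evaluation of a polynomial at \<open>a\<close> by Horner's rule in the corner of
  \<open>e\<close>; constants become multiples of the local unit \<open>e\<close>, not of
  \<open>U\<close>, so that values stay in the corner.\<close>

definition peval :: "'v \<Rightarrow> 'v \<Rightarrow> 'k poly \<Rightarrow> 'v" where
  "peval e a p = fold_coeffs (\<lambda>c y. c \<cdot> e + a \<star> y) p 0"

lemma peval_0 [simp]: "peval e a 0 = 0"
  by (simp add: peval_def)

lemma peval_pCons [simp]: "a \<in> V \<Longrightarrow> peval e a (pCons c p) = c \<cdot> e + a \<star> peval e a p"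
  by (cases "p = 0 \<and> c = 0") (auto simp: peval_def)

lemma peval_corner:
  assumes "idem e" "a \<in> corner e"
  shows "peval e a p \<in> corner e"
proof -
  have e: "e \<in> corner e" using idemD[OF assms(1)] by (simp add: corner_def)
  have a: "a \<in> V" using assms comp_V by (auto simp: corner_def)
  note sub = corner_subspace[OF assms(1)]
  show ?thesis
    by (induction p) (use a e assms in \<open>auto intro!: vs.subspace_add[OF sub] vs.subspace_0[OF sub]
      vs.subspace_scale[OF sub] corner_mul\<close>)
qed

lemma corner_V: "x \<in> corner e \<Longrightarrow> x \<in> V"
  using comp_V by (auto simp: corner_def)

lemma peval_add:
  assumes "idem e" "a \<in> corner e"
  shows "peval e a (p + q) = peval e a p + peval e a q"
proof -
  note V = corner_V[OF assms(2)] peval_corner[OF assms, THEN corner_V] idemD(2)[OF assms(1)]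
  show ?thesis
    by (induction p q rule: poly_induct2)
      (use V in \<open>auto simp: mul_add_right vs.scale_left_distrib algebra_simps\<close>)
qed

lemma peval_smult:
  assumes "idem e" "a \<in> corner e"
  shows "peval e a (smult c p) = c \<cdot> peval e a p"
proof -
  note V = corner_V[OF assms(2)] peval_corner[OF assms, THEN corner_V] idemD(2)[OF assms(1)]
  show ?thesis
    by (induction p) (use V in \<open>auto simp: vs.scale_right_distrib\<close>)
qed

lemma peval_sum:
  assumes "idem e" "a \<in> corner e"
  shows "peval e a (sum p I) = (\<Sum>i\<in>I. peval e a (p i))"
  by (induction I rule: infinite_finite_induct) (simp_all add: peval_add[OF assms])

text \<open>There are more powers of \<open>a\<close> up to the exponent \<open>n\<close> than the
  dimension allows to be independent. Dependence is a property of sets, so a coincidence of two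
  powers is a case of its own, settled by a difference of monomials.\<close>

lemma peval_annihilator:
  assumes "idem e" "a \<in> corner e"
  obtains p where "p \<noteq> 0" "peval e a p = 0"
proof -
  obtain B where B: "finite B" "vs.span B = V" using V_finite_span by blast
  define m where "m = (\<lambda>i. peval e a (monom 1 i))"
  define n where "n = card B"
  show ?thesis
  proof (cases "inj_on m {..n}")
    case True
    have "card (m ` {..n}) > card B" unfolding card_image[OF True] by (simp add: n_def)
    then have "vs.dependent (m ` {..n})"
      using vs.independent_span_bound[OF B(1), of "m ` {..n}"] peval_corner[OF assms] corner_V B(2)
      by (force simp: m_def)
    then obtain u v where uv: "v \<in> m ` {..n}" "u v \<noteq> 0" "(\<Sum>v\<in>m ` {..n}. u v \<cdot> v) = 0"
      using vs.dependent_finite[of "m ` {..n}"] by auto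
    define p where "p = (\<Sum>i\<le>n. monom (u (m i)) i)"
    have "peval e a p = (\<Sum>i\<le>n. u (m i) \<cdot> m i)"
      unfolding p_def peval_sum[OF assms] m_def
      by (rule sum.cong[OF refl]) (simp flip: peval_smult[OF assms] add: smult_monom)
    also have "\<dots> = 0" using uv(3) by (simp add: sum.reindex[OF True])
    finally have "peval e a p = 0" .
    moreover obtain i where "i \<le> n" "v = m i" using uv(1) by auto
    then have "coeff p i \<noteq> 0" using uv(2) by (simp add: p_def coeff_sum)
    then have "p \<noteq> 0" by auto
    ultimately show ?thesis using that by blast
  next
    case False
    then obtain i j where ij: "i \<noteq> j" "m i = m j" by (auto simp: inj_on_def)
    have "peval e a (monom 1 i + smult (-1) (monom 1 j)) = 0"
      unfolding peval_add[OF assms] peval_smult[OF assms] using ij by (simp add: m_def)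
    moreover have "coeff (monom 1 i + smult (-1) (monom 1 j)) i \<noteq> (0::'k)" using ij by simp
    then have "monom 1 i + smult (-1) (monom 1 j) \<noteq> (0::'k poly)" by (metis coeff_0)
    ultimately show ?thesis using that by blast
  qed
qed

lemma peval_minimal:
  assumes "idem e" "a \<in> corner e"
  obtains p where "p \<noteq> 0" "peval e a p = 0"
    "\<And>q. q \<noteq> 0 \<Longrightarrow> degree q < degree p \<Longrightarrow> peval e a q \<noteq> 0"
proof -
  obtain p0 where "p0 \<noteq> 0 \<and> peval e a p0 = 0" using peval_annihilator[OF assms] by blast
  from ex_has_least_nat[of "\<lambda>p. p \<noteq> 0 \<and> peval e a p = 0", OF this, of degree]
  show ?thesis using that leD by blast
qed

text \<open>If the annihilating polynomial of least degree has constant term zero, its linear coefficient is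
  nonzero because the algebra is reduced; hence \<open>a = a\<^sup>2 t\<close>, and \<open>a t\<close> is a nonzero idempotent below
  \<open>e\<close>.\<close>

lemma corner_invertible:
  assumes e: "primitive e" and a: "a \<in> corner e" "a \<noteq> 0"
  obtains t where "t \<in> corner e" "a \<star> t = e"
proof -
  note found = that
  have id: "idem e" using e by (simp add: primitive_def)
  note pc = peval_corner[OF id a(1)]
  note e1 = idemD[OF id]
  have cV: "x \<in> V" "x \<in> C \<one>" "e \<star> x = x" "x \<star> e = x" if "x \<in> corner e" for x
    using that e1 comm_one comp_V by (auto simp: corner_def)
  note aV = cV[OF a(1)]
  note sub = corner_subspace[OF id]
  note cs = vs.subspace_scale[OF sub]
  obtain p where p: "p \<noteq> 0" "peval e a p = 0"
    and min: "\<And>q. q \<noteq> 0 \<Longrightarrow> degree q < degree p \<Longrightarrow> peval e a q \<noteq> 0"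
    using peval_minimal[OF id a(1)] by blast
  obtain c q where pq: "p = pCons c q" by (cases p)
  let ?y = "peval e a q"
  have eq: "c \<cdot> e + a \<star> ?y = 0" using p aV by (simp add: pq)
  have inv_of: thesis if "c \<noteq> 0" "y \<in> corner e" "c \<cdot> e + a \<star> y = 0" for c y
  proof (rule found)
    show "(- inverse c) \<cdot> y \<in> corner e" using that cs by blast
    have "a \<star> y = - (c \<cdot> e)" using that(3) by (metis add.commute add_eq_0_iff)
    then show "a \<star> ((- inverse c) \<cdot> y) = e"
      using that(1) aV cV[OF that(2)] by simp
  qed
  show thesis
  proof (cases "c = 0")
    case False
    then show ?thesis using inv_of[OF _ pc eq] by blast
  next
    case True
    then have ay: "a \<star> ?y = 0" using eq by simp
    have q0: "q \<noteq> 0" using p True pq by auto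
    then have y0: "?y \<noteq> 0" using min[of q] pq by simp
    obtain d r where qr: "q = pCons d r" by (cases q)
    let ?z = "peval e a r"
    note zV = cV[OF pc[of r]]
    have yz: "?y = d \<cdot> e + a \<star> ?z" using aV by (simp add: qr)
    show ?thesis
    proof (cases "d = 0")
      case True
      then have y: "?y = a \<star> ?z" using yz by simp
      \<comment> \<open>Now \<open>?y\<close> is a multiple of \<open>a\<close> and is killed by
        \<open>a\<close>, so its square is 0. Reducedness makes \<open>?y\<close> itself 0, against
        the minimality of the degree of \<open>p\<close>.\<close>
      have "?y \<star> ?y = (a \<star> ?y) \<star> ?z"
        using aV zV cV[OF pc[of q]] y by (metis one_part_assoc one_part_comm)
      then have "?y \<star> ?y = 0" using ay zV by simp
      then show ?thesis using reduced y0 cV[OF pc[of q]] by blast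
    next
      case False
      define t where "t = (- inverse d) \<cdot> ?z"
      have t: "t \<in> corner e" unfolding t_def using cs pc by blast
      note tV = cV[OF t]
      have "d \<cdot> a + a \<star> (a \<star> ?z) = 0"
        using ay aV zV e1 mul_comp_one by (simp add: yz mul_add_right)
      then have "a \<star> (a \<star> ?z) = - (d \<cdot> a)" by (metis add.commute add_eq_0_iff)
      then have aat: "a \<star> (a \<star> t) = a" unfolding t_def using False aV zV by simp
      let ?q = "a \<star> t"
      have "idem ?q" unfolding idem_def
        using aV tV aat by (metis mul_comp_one(1) one_part_assoc one_part_comm)
      moreover have "?q \<noteq> 0" using aat a aV by auto
      moreover have "?q \<star> e = ?q" using cV(4) corner_mul[OF id a(1) t] by blast
      ultimately have "?q = e" using e by (simp add: primitive_def)
      then show ?thesis using t that by blast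
    qed
  qed
qed

text \<open>The corner is a field of finite dimension over an algebraically closed one. Concretely,
  a root \<open>l\<close> splits the minimal polynomial as (X - l) q; the value of \<open>q\<close>
  at \<open>a\<close> is nonzero by minimality, hence invertible, which leaves
  \<open>a = l \<cdot> e\<close>.\<close>

lemma corner_scalar:
  assumes e: "primitive e" and a: "a \<in> corner e"
  obtains c where "a = c \<cdot> e"
proof -
  have id: "idem e" "e \<noteq> 0" using e by (auto simp: primitive_def)
  note pc = peval_corner[OF id(1) a]
  note e1 = idemD[OF id(1)]
  note aV = corner_V[OF a]
  obtain p where p: "p \<noteq> 0" "peval e a p = 0"
    and min: "\<And>q. q \<noteq> 0 \<Longrightarrow> degree q < degree p \<Longrightarrow> peval e a q \<noteq> 0"
    using peval_minimal[OF id(1) a] by blast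
  have "degree p > 0"
  proof (rule ccontr)
    assume "\<not> degree p > 0"
    then obtain c where "p = [:c:]" using degree_0_id by (metis neq0_conv)
    then show False using p id aV by simp
  qed
  then obtain l where "poly p l = 0" using alg_closed_imp_poly_has_root by blast
  then obtain q where pq: "p = [:- l, 1:] * q" using poly_eq_0_iff_dvd by blast
  have q0: "q \<noteq> 0" using p pq by auto
  then have "degree p = Suc (degree q)" unfolding pq by (subst degree_mult_eq) auto
  then have y0: "peval e a q \<noteq> 0" using min q0 by simp
  let ?y = "peval e a q"
  have yV: "?y \<in> V" "e \<star> ?y = ?y" using pc[of q] corner_V by (auto simp: corner_def)
  have "p = smult (- l) q + pCons 0 q" by (simp add: pq)
  then have "peval e a p = peval e a (smult (- l) q) + peval e a (pCons 0 q)"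
    by (simp only: peval_add[OF id(1) a])
  also have "\<dots> = (- l) \<cdot> ?y + a \<star> ?y"
    unfolding peval_smult[OF id(1) a] using aV by simp
  finally have "peval e a p = (- l) \<cdot> ?y + a \<star> ?y" .
  then have 0: "(a - l \<cdot> e) \<star> ?y = 0"
    using p aV yV e1 by (simp add: mul_diff_left)
  obtain t where t: "t \<in> corner e" "?y \<star> t = e" using corner_invertible[OF e pc y0] .
  have ale: "a - l \<cdot> e \<in> corner e"
    using a e1 aV by (auto simp: corner_def comp_diff comp_scale mul_diff_right)
  have "a - l \<cdot> e = (a - l \<cdot> e) \<star> e"
    using ale e1 comm_one[of e "a - l \<cdot> e"] corner_V[OF ale] by (simp add: corner_def)
  also have "\<dots> = ((a - l \<cdot> e) \<star> ?y) \<star> t"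
    using ale t pc[of q] one_part_assoc[of "a - l \<cdot> e" ?y t] by (simp add: corner_def)
  also have "\<dots> = 0" using 0 corner_V[OF t(1)] by simp
  finally have "a = l \<cdot> e" by simp
  then show ?thesis by (rule that)
qed

section \<open>Conjugates of primitive idempotents\<close>

lemma act_idem: "f \<in> carrier G \<Longrightarrow> idem p \<Longrightarrow> idem (f \<triangleright> p)"
  using act_mul_one[of f p p] idemD[of p] act_comp_one[of f p] unfolding idem_def by metis

lemma act_inv_cancel:
  assumes "f \<in> carrier G" "x \<in> C \<one>"
  shows "f \<triangleright> (inv f \<triangleright> x) = x" "inv f \<triangleright> (f \<triangleright> x) = x"
  using assms act_mult_one[of f "inv f" x] act_mult_one[of "inv f" f x] comp_V by auto

lemma act_primitive:
  assumes f: "f \<in> carrier G" and e: "primitive e"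
  shows "primitive (f \<triangleright> e)"
proof -
  have id: "idem e" "e \<noteq> 0" using e by (auto simp: primitive_def)
  have "f \<triangleright> e \<noteq> 0" using act_inj[of f e 0] f id idemD(2)[OF id(1)] by simp
  moreover have "q = f \<triangleright> e" if q: "idem q" "q \<noteq> 0" "q \<star> (f \<triangleright> e) = q" for q
  proof -
    note c = act_inv_cancel[OF f] idemD[OF id(1)] idemD[OF q(1)]
    have "inv f \<triangleright> q = (inv f \<triangleright> q) \<star> e"
      using act_mul_one[of "inv f" q "f \<triangleright> e"] q f c by simp
    moreover have "inv f \<triangleright> q \<noteq> 0" using act_inj[of "inv f" q 0] f q c by simp
    ultimately have "inv f \<triangleright> q = e"
      using e act_idem[of "inv f" q] f q by (simp add: primitive_def)
    then show ?thesis using c by metis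
  qed
  ultimately show ?thesis using act_idem[OF f id(1)] by (simp add: primitive_def)
qed

text \<open>The product is an idempotent below both factors; if it were nonzero, primitivity would
  make it equal to each of them.\<close>

lemma primitive_orthogonal:
  assumes "primitive e" "primitive q" "e \<noteq> q"
  shows "e \<star> q = 0"
proof (rule ccontr)
  assume ne: "e \<star> q \<noteq> 0"
  have e: "e \<in> C \<one>" "e \<star> e = e" and q: "q \<in> C \<one>" "q \<star> q = q"
    using assms by (auto simp: primitive_def idem_def)
  note r = mul_comp_one[OF e(1) q(1)] one_part_assoc one_part_lcomm one_part_comm
  have "idem (e \<star> q)" "(e \<star> q) \<star> e = e \<star> q" "(e \<star> q) \<star> q = e \<star> q"
    unfolding idem_def using r(1) e q
    by (simp_all add: one_part_assoc one_part_lcomm[of q e q] one_part_comm[of q e])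
      (simp add: e flip: one_part_assoc)+
  then show False using ne assms by (auto simp: primitive_def)
qed

end

section \<open>The corner of a primitive idempotent\<close>

locale etale_corner = etale_zalg G \<alpha> A
  for G :: "('g, 'b) monoid_scheme" (structure)
    and \<alpha> :: "'g \<Rightarrow> 'g \<Rightarrow> 'g \<Rightarrow> 'k::alg_closed_field"
    and A :: "('k, 'g, 'v::ab_group_add) graded_alg" +
  fixes e :: 'v
  assumes prim: "primitive e"
begin

lemma e: "idem e" "e \<noteq> 0" "e \<in> C \<one>" "e \<in> V" "e \<star> e = e"
  using prim idemD by (auto simp: primitive_def)

text \<open>A set of idempotents, not a family over \<open>G\<close>: sums over it count each
  conjugate once, without the order of the stabiliser as a multiplicity.\<close>

definition orb :: "'v set" where "orb = (\<lambda>g. g \<triangleright> e) ` carrier G"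

lemma orb_finite: "finite orb"
  using fin by (simp add: orb_def)

lemma orb_primitive: "q \<in> orb \<Longrightarrow> primitive q"
  using act_primitive prim by (auto simp: orb_def)

lemma orb_V: "q \<in> orb \<Longrightarrow> q \<in> V" "q \<in> orb \<Longrightarrow> q \<in> C \<one>"
  using orb_primitive idemD by (auto simp: primitive_def)

lemma orb_mul:
  assumes "q \<in> orb" "r \<in> orb"
  shows "q \<star> r = (if q = r then q else 0)"
proof (cases "q = r")
  case True
  have "idem q" using orb_primitive[OF assms(1)] by (simp add: primitive_def)
  then show ?thesis using True idemD(3) by simp
next
  case False
  then show ?thesis using orb_primitive assms primitive_orthogonal by simp
qed

lemma e_orb: "e \<in> orb"
  unfolding orb_def by (rule image_eqI[of _ _ \<one>]) (simp_all add: e)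

lemma act_orb: "f \<in> carrier G \<Longrightarrow> q \<in> orb \<Longrightarrow> f \<triangleright> q \<in> orb"
  using e(3) by (auto simp: orb_def simp flip: act_mult_one)

text \<open>This is the form in which transitivity is used: other primitive idempotents are never
  considered. The sum is nonzero because its product with \<open>e\<close> is
  \<open>e\<close>.\<close>

lemma sum_orb: "\<Sum>orb = U"
proof -
  have p1: "\<Sum>orb \<in> C \<one>" using orb_V by (intro comp_sum) auto
  have mulp: "q \<star> \<Sum>orb = q" if "q \<in> orb" for q
    using that orb_V orb_finite by (simp add: mul_sum_right[of orb "\<lambda>x. x"] orb_mul)
  have "\<Sum>orb \<star> \<Sum>orb = (\<Sum>q\<in>orb. q \<star> \<Sum>orb)"
    using orb_V orb_finite comp_V[OF p1] by (intro mul_sum_left) auto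
  then have "idem (\<Sum>orb)" using p1 mulp by (simp add: idem_def)
  moreover have "f \<triangleright> \<Sum>orb = \<Sum>orb" if f: "f \<in> carrier G" for f
  proof -
    have "f \<triangleright> \<Sum>orb = (\<Sum>q\<in>orb. f \<triangleright> q)"
      using orb_V orb_finite f by (simp add: act_sum)
    also have "\<dots> = \<Sum>orb"
      using f act_orb act_inv_cancel[OF f] orb_V
      by (intro sum.reindex_bij_witness[of _ "\<lambda>q. inv f \<triangleright> q" "\<lambda>q. f \<triangleright> q"]) auto
    finally show ?thesis .
  qed
  moreover have "\<Sum>orb \<noteq> 0" using mulp[OF e_orb] e by auto
  ultimately show ?thesis using invariant_idem_trivial by blast
qed

section \<open>The stabiliser and the homogeneous parts of the corner\<close>

definition H :: "'g set" where "H = {h \<in> carrier G. h \<triangleright> e = e}"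

definition E :: "'g \<Rightarrow> 'v set" where "E g = {x \<in> C g. e \<star> x = x}"

definition F :: "'g set" where "F = {f \<in> carrier G. E f \<noteq> {0}}"

lemma H_subgroup: "subgroup H G"
proof (rule subgroupI)
  show "H \<subseteq> carrier G" "H \<noteq> {}" using e by (auto simp: H_def)
  show "inv h \<in> H" if "h \<in> H" for h
    using that act_inv_cancel(2)[of h e] e by (auto simp: H_def)
  show "h \<otimes> k \<in> H" if "h \<in> H" "k \<in> H" for h k
    using that act_mult_one[of h k e] e by (auto simp: H_def)
qed

lemma H_carrier: "h \<in> H \<Longrightarrow> h \<in> carrier G"
  by (simp add: H_def)

lemma E_subspace: "vs.subspace (E g)"
  unfolding E_def using fixed_subspace e comp_subspace comp_subset_V by blast

lemma ED: "x \<in> E g \<Longrightarrow> x \<in> C g" "x \<in> E g \<Longrightarrow> x \<in> V" "x \<in> E g \<Longrightarrow> e \<star> x = x"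
  "x \<in> E g \<Longrightarrow> x \<star> e = x"
  using comp_V comm_one e by (auto simp: E_def)

lemma E_0 [simp]: "0 \<in> E g"
  using vs.subspace_0[OF E_subspace] .

lemma E_mul_e: "x \<in> C g \<Longrightarrow> e \<star> x \<in> E g"
  using e mul_comp_one comp_V by (simp add: E_def assoc_one(1))

lemma E_carrier: "x \<in> E g \<Longrightarrow> x \<noteq> 0 \<Longrightarrow> g \<in> carrier G"
  using comp_outside by (auto simp: E_def)

text \<open>Braided commutativity turns x = x e into x = (g.e) x, hence x = (e (g.e)) x. Conjugates
  of \<open>e\<close> are orthogonal or equal, so \<open>x \<noteq> 0\<close> forces
  \<open>g\<close> to fix \<open>e\<close>.\<close>

lemma E_H:
  assumes "x \<in> E g" "x \<noteq> 0"
  shows "g \<in> H"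
proof -
  note g = E_carrier[OF assms]
  note x = ED[OF assms(1)]
  have ge: "g \<triangleright> e \<in> C \<one>" "g \<triangleright> e \<in> orb" using g e act_comp_one by (auto simp: orb_def)
  have "x = (g \<triangleright> e) \<star> x" using comm[OF x(1) e(4) g] x by simp
  then have "x = (e \<star> (g \<triangleright> e)) \<star> x"
    using assoc_one(1)[OF e(3) comp_V[OF ge(1)] x(2)] x by simp
  then show ?thesis using orb_mul[OF e_orb ge(2)] g assms x by (auto simp: H_def split: if_splits)
qed

lemma E_one: "x \<in> E \<one> \<Longrightarrow> \<exists>c. x = c \<cdot> e"
  using corner_scalar[OF prim] by (metis E_def corner_def)

lemma E_mul:
  assumes "x \<in> E f" "y \<in> E g"
  shows "x \<star> y \<in> E (f \<otimes> g)"
proof (cases "x = 0 \<or> y = 0")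
  case True
  then have "x \<star> y = 0" using ED(2)[OF assms(1)] ED(2)[OF assms(2)] by auto
  then show ?thesis by simp
next
  case False
  then have "x \<star> y \<in> C (f \<otimes> g)" using assms by (intro mul_comp ED E_carrier) auto
  moreover have "e \<star> (x \<star> y) = x \<star> y"
    using assoc_one(1)[OF e(3) ED(2)[OF assms(1)] ED(2)[OF assms(2)]] ED(3)[OF assms(1)] by simp
  ultimately show ?thesis by (simp add: E_def)
qed

lemma E_act:
  assumes "h \<in> H" "x \<in> E f" "f \<in> carrier G"
  shows "h \<triangleright> x \<in> E (cj h f)"
proof -
  have h: "h \<in> carrier G" "h \<triangleright> e = e" using assms by (auto simp: H_def)
  have "h \<triangleright> x \<in> C (cj h f)" using act_comp h assms(3) ED(1)[OF assms(2)] by blast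
  moreover have "e \<star> (h \<triangleright> x) = h \<triangleright> x"
    using act_mul_one[OF h(1) e(3) ED(2)[OF assms(2)]] h ED(3)[OF assms(2)] by simp
  ultimately show ?thesis by (simp add: E_def)
qed

lemma E_invertible:
  assumes "x \<in> E f" "x \<noteq> 0"
  obtains y where "y \<in> E (inv f)" "x \<star> y = e"
proof -
  note f = E_carrier[OF assms]
  obtain b where b: "b \<in> C (inv f)" "x \<star> b \<noteq> 0"
    using homogeneous_nondeg[OF ED(1)[OF assms(1)] f assms(2)] .
  have eb: "e \<star> b \<in> E (inv f)" using E_mul_e b by blast
  \<comment> \<open>Moving \<open>b\<close> into the corner loses nothing: x(eb) = (xe)b =
    xb.\<close>
  have xb: "x \<star> (e \<star> b) = x \<star> b"
    using assoc_one(2)[OF e(3) ED(2)[OF assms(1)] comp_V[OF b(1)]] ED(4)[OF assms(1)] by simp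
  have "x \<star> (e \<star> b) \<in> E \<one>" using E_mul[OF assms(1) eb] f by simp
  then obtain c where c: "x \<star> (e \<star> b) = c \<cdot> e" using E_one by blast
  then have "c \<noteq> 0" using xb b by auto
  then have "x \<star> (inverse c \<cdot> (e \<star> b)) = e"
    using c ED(2)[OF assms(1)] ED(2)[OF eb] by simp
  then show ?thesis using that vs.subspace_scale[OF E_subspace eb] by blast
qed

text \<open>With a right inverse \<open>z\<close> of \<open>y\<close>, x = x(yz) is a scalar
  multiple of (xy)z; the scalar from reassociation does no harm.\<close>

lemma E_mul_nz:
  assumes "x \<in> E f" "x \<noteq> 0" "y \<in> E g" "y \<noteq> 0"
  shows "x \<star> y \<noteq> 0"
proof
  assume 0: "x \<star> y = 0"
  note fg = E_carrier[OF assms(1,2)] E_carrier[OF assms(3,4)]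
  obtain z where z: "z \<in> E (inv g)" "y \<star> z = e" using E_invertible assms(3,4) by blast
  have "x = x \<star> (y \<star> z)" using z ED assms by simp
  also have "\<dots> = 0"
    using mul_assoc[of x f y g z "inv g"] ED(1)[OF assms(1)] ED(1)[OF assms(3)] ED[OF z(1)] fg 0 by simp
  finally show False using assms by simp
qed

text \<open>If x z = e and y z = c e, then (y - c x) z = 0, and nonzero homogeneous elements of the
  corner have nonzero products. Subtracting before cancelling \<open>z\<close> avoids any
  reassociation.\<close>

lemma E_line:
  assumes "x \<in> E f" "x \<noteq> 0" "y \<in> E f"
  obtains c where "y = c \<cdot> x"
proof -
  note f = E_carrier[OF assms(1,2)]
  obtain z where z: "z \<in> E (inv f)" "x \<star> z = e" using E_invertible assms(1,2) by blast
  have "z \<noteq> 0" using z e ED(2)[OF assms(1)] by auto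
  have "y \<star> z \<in> E \<one>" using E_mul[OF assms(3) z(1)] f by simp
  then obtain c where c: "y \<star> z = c \<cdot> e" using E_one by blast
  have "(y - c \<cdot> x) \<star> z = 0"
    using c z ED[OF assms(1)] ED[OF assms(3)] ED[OF z(1)] by (simp add: mul_diff_left)
  moreover have "y - c \<cdot> x \<in> E f"
    using assms vs.subspace_diff[OF E_subspace] vs.subspace_scale[OF E_subspace] by blast
  ultimately have "y - c \<cdot> x = 0" using E_mul_nz z(1) \<open>z \<noteq> 0\<close> by blast
  then have "y = c \<cdot> x" by simp
  then show ?thesis by (rule that)
qed

section \<open>The support as a normal subgroup of the stabiliser\<close>

lemma F_iff: "f \<in> F \<longleftrightarrow> (\<exists>x. x \<in> E f \<and> x \<noteq> 0)"
  using E_carrier E_0 by (auto simp: F_def)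

lemma E_outside_F: "f \<notin> F \<Longrightarrow> x \<in> E f \<Longrightarrow> x = 0"
  by (auto simp: F_iff)

lemma F_H: "f \<in> F \<Longrightarrow> f \<in> H"
  using E_H F_iff by blast

lemma F_carrier: "f \<in> F \<Longrightarrow> f \<in> carrier G"
  using F_H H_carrier by blast

lemma F_finite: "finite F"
  using fin by (simp add: F_def)

lemma e_E: "e \<in> E \<one>"
  using e by (simp add: E_def)

lemma F_one: "\<one> \<in> F"
  using e_E e F_iff by blast

lemma F_mult: "f \<in> F \<Longrightarrow> g \<in> F \<Longrightarrow> f \<otimes> g \<in> F"
  using E_mul E_mul_nz by (metis F_iff)

lemma F_conj: "h \<in> H \<Longrightarrow> f \<in> F \<Longrightarrow> cj h f \<in> F"
  using E_act act_inj[of h _ 0] by (metis F_iff F_carrier H_carrier ED(2) V_0 act_0)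

lemma F_subgroup: "subgroup F G"
proof (rule subgroupI)
  show "F \<subseteq> carrier G" "F \<noteq> {}" using F_carrier F_one by blast+
  show "inv f \<in> F" if f: "f \<in> F" for f
  proof -
    obtain x where x: "x \<in> E f" "x \<noteq> 0" using f F_iff by blast
    obtain y where y: "y \<in> E (inv f)" "x \<star> y = e" using E_invertible[OF x] .
    then have "y \<noteq> 0" using e ED(2)[OF x(1)] by auto
    then show ?thesis using y F_iff by blast
  qed
qed (rule F_mult)

lemma F_normal: "F \<lhd> (G\<lparr>carrier := H\<rparr>)"
proof -
  interpret K: group "G\<lparr>carrier := H\<rparr>" using H_subgroup subgroup_imp_group by blast
  have "subgroup F (G\<lparr>carrier := H\<rparr>)"
    using subgroup_incl[OF F_subgroup H_subgroup] F_H by blast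
  then show ?thesis
    using F_conj m_inv_consistent[OF H_subgroup] by (simp add: K.normal_inv_iff conjg_def)
qed

text \<open>The vectors are arbitrary except in degree one, where the choice \<open>e\<close> makes
  \<open>gam\<close> normalised.\<close>

definition bas :: "'g \<Rightarrow> 'v" where
  "bas f = (if f = \<one> then e else SOME x. x \<in> E f \<and> x \<noteq> 0)"

definition crd :: "'g \<Rightarrow> 'v \<Rightarrow> 'k" where
  "crd f w = (THE c. w = c \<cdot> bas f)"

definition gam :: "'g \<Rightarrow> 'g \<Rightarrow> 'k" where
  "gam f g = crd (f \<otimes> g) (bas f \<star> bas g)"

definition eps :: "'g \<Rightarrow> 'g \<Rightarrow> 'k" where
  "eps h f = crd (cj h f) (h \<triangleright> bas f)"

lemma bas:
  assumes "f \<in> F"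
  shows "bas f \<in> E f" "bas f \<noteq> 0"
proof -
  have "bas f \<in> E f \<and> bas f \<noteq> 0"
    using assms someI_ex[of "\<lambda>x. x \<in> E f \<and> x \<noteq> 0"] e_E e by (auto simp: bas_def F_iff)
  then show "bas f \<in> E f" "bas f \<noteq> 0" by auto
qed

lemma bas_one [simp]: "bas \<one> = e"
  by (simp add: bas_def)

lemma bas_V: "f \<in> F \<Longrightarrow> bas f \<in> V"
  using bas ED by blast

lemma bas_C: "f \<in> F \<Longrightarrow> bas f \<in> C f"
  using bas ED by blast

lemma crd_scale [simp]: "f \<in> F \<Longrightarrow> crd f (c \<cdot> bas f) = c"
  using bas by (auto simp: crd_def)

lemma crd_bas [simp]: "f \<in> F \<Longrightarrow> crd f (bas f) = 1"
  using crd_scale[of f 1] by simp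

lemma crd_eq: "f \<in> F \<Longrightarrow> w \<in> E f \<Longrightarrow> w = crd f w \<cdot> bas f"
  using E_line[of "bas f" f w] bas crd_scale by metis

lemma gam_eq: "f \<in> F \<Longrightarrow> g \<in> F \<Longrightarrow> bas f \<star> bas g = gam f g \<cdot> bas (f \<otimes> g)"
  unfolding gam_def by (rule crd_eq[OF F_mult E_mul]) (simp_all add: bas)

lemma eps_eq: "h \<in> H \<Longrightarrow> f \<in> F \<Longrightarrow> h \<triangleright> bas f = eps h f \<cdot> bas (cj h f)"
  unfolding eps_def by (rule crd_eq[OF F_conj E_act]) (simp_all add: bas F_carrier)

lemma bas_cancel: "f \<in> F \<Longrightarrow> c \<cdot> bas f = d \<cdot> bas f \<Longrightarrow> c = d"
  using bas by simp

lemma gam_nz: "f \<in> F \<Longrightarrow> g \<in> F \<Longrightarrow> gam f g \<noteq> 0"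
  using gam_eq[of f g] E_mul_nz[of "bas f" f "bas g" g] bas by (metis vs.scale_zero_left)

lemma eps_nz:
  assumes "h \<in> H" "f \<in> F"
  shows "eps h f \<noteq> 0"
proof
  assume 0: "eps h f = 0"
  have "h \<triangleright> bas f = h \<triangleright> 0" unfolding eps_eq[OF assms] 0 using H_carrier[OF assms(1)] by simp
  then show False
    using act_inj[OF H_carrier[OF assms(1)] bas_V[OF assms(2)] V_0] bas(2)[OF assms(2)] by blast
qed

lemma normalised_cochain2_gam: "normalised_cochain2 G F gam"
proof -
  have "gam \<one> g = 1" "gam g \<one> = 1" if "g \<in> F" for g
    using that ED(3,4)[OF bas(1)[OF that]] F_carrier[OF that] by (simp_all add: gam_def)
  then show ?thesis unfolding normalised_cochain2_def using gam_nz by blast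
qed

text \<open>Each condition on \<open>gam\<close> and \<open>eps\<close>, here and in the next three
  lemmas, compares coefficients of one basis vector in one axiom: associativity, the projective
  action, its compatibility with products, and braided commutativity.\<close>

lemma coboundary2_gam:
  assumes "f \<in> F" "g \<in> F" "h \<in> F"
  shows "coboundary2 G gam f g h = \<alpha> f g h"
proof -
  note c = assms[THEN F_carrier] assms[THEN bas_V] F_mult bas_V assms
  have "bas f \<star> (bas g \<star> bas h) = (gam g h * gam f (g \<otimes> h)) \<cdot> bas (f \<otimes> g \<otimes> h)"
    using c by (simp add: gam_eq m_assoc)
  moreover have "bas f \<star> (bas g \<star> bas h) = \<alpha> f g h \<cdot> ((bas f \<star> bas g) \<star> bas h)"
    using c bas_C by (intro mul_assoc) auto
  moreover have "(bas f \<star> bas g) \<star> bas h = (gam f g * gam (f \<otimes> g) h) \<cdot> bas (f \<otimes> g \<otimes> h)"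
    using c by (simp add: gam_eq)
  ultimately have "(gam g h * gam f (g \<otimes> h)) \<cdot> bas (f \<otimes> g \<otimes> h)
      = (\<alpha> f g h * (gam f g * gam (f \<otimes> g) h)) \<cdot> bas (f \<otimes> g \<otimes> h)"
    by (metis vs.scale_scale)
  then have "gam g h * gam f (g \<otimes> h) = \<alpha> f g h * (gam f g * gam (f \<otimes> g) h)"
    using bas_cancel[of "f \<otimes> g \<otimes> h"] c by blast
  then show ?thesis using gam_nz c by (simp add: coboundary2_def field_simps)
qed

lemma eps_mult:
  assumes "g \<in> H" "h \<in> H" "f \<in> F"
  shows "eps (g \<otimes> h) f = eps g (cj h f) * eps h f * cocycle_act G \<alpha> g h f"
proof -
  note c = assms H_carrier[OF assms(1)] H_carrier[OF assms(2)] F_carrier[OF assms(3)]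
  have gh: "g \<otimes> h \<in> H" using assms H_subgroup by (simp add: subgroup.m_closed)
  have "eps (g \<otimes> h) f \<cdot> bas (cj g (cj h f)) = (g \<otimes> h) \<triangleright> bas f"
    using eps_eq[OF gh assms(3)] c by (simp add: cj_mult)
  also have "\<dots> = cocycle_act G \<alpha> g h f \<cdot> (g \<triangleright> (h \<triangleright> bas f))"
    using act_mult c bas_C by blast
  also have "\<dots> = (eps g (cj h f) * eps h f * cocycle_act G \<alpha> g h f) \<cdot> bas (cj g (cj h f))"
    using c F_conj bas_V by (simp add: eps_eq act_scale mult_ac)
  finally show ?thesis using bas_cancel F_conj assms by blast
qed

lemma gam_eps:
  assumes "h \<in> H" "f \<in> F" "g \<in> F"
  shows "gam f g * eps h (f \<otimes> g) =
    cocycle_tensor G \<alpha> h f g * eps h f * eps h g * gam (cj h f) (cj h g)"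
proof -
  note c = assms H_carrier[OF assms(1)] F_carrier[OF assms(2)] F_carrier[OF assms(3)]
  have cjm: "cj h f \<otimes> cj h g = cj h (f \<otimes> g)"
    using c by (simp add: conjg_def m_assoc) (simp flip: m_assoc)
  have "(gam f g * eps h (f \<otimes> g)) \<cdot> bas (cj h (f \<otimes> g)) = h \<triangleright> (bas f \<star> bas g)"
    using c F_mult bas_V by (simp add: gam_eq act_scale eps_eq)
  also have "\<dots> = cocycle_tensor G \<alpha> h f g \<cdot> ((h \<triangleright> bas f) \<star> (h \<triangleright> bas g))"
    using c bas_C by (intro act_mul) auto
  also have "\<dots> = (cocycle_tensor G \<alpha> h f g * eps h f * eps h g * gam (cj h f) (cj h g))
      \<cdot> bas (cj h (f \<otimes> g))"
    using c F_conj bas_V by (simp add: eps_eq gam_eq cjm mult_ac)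
  finally show ?thesis using bas_cancel F_conj F_mult assms by blast
qed

lemma gam_comm:
  assumes "f \<in> F" "g \<in> F"
  shows "gam f g = eps f g * gam (cj f g) f"
proof -
  note c = assms assms[THEN F_carrier] assms[THEN F_H]
  \<comment> \<open>Both sides of e_f e_g = (f.e_g) e_f are thus multiples of the same basis
    vector.\<close>
  have cjm: "cj f g \<otimes> f = f \<otimes> g"
    using c by (simp add: conjg_def m_assoc)
  have "gam f g \<cdot> bas (f \<otimes> g) = (f \<triangleright> bas g) \<star> bas f"
    using c bas_C bas_V by (simp add: comm[of "bas f" f] flip: gam_eq)
  also have "\<dots> = (eps f g * gam (cj f g) f) \<cdot> bas (f \<otimes> g)"
    using c F_conj bas_V by (simp add: eps_eq gam_eq cjm)
  finally show ?thesis using bas_cancel F_mult assms by blast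
qed

end

section \<open>The isomorphism with the model\<close>

lemma fscale_simps [simp]:
  "fscale 0 v = 0" "fscale c 0 = 0" "fscale 1 v = v" "fscale c (fscale d v) = fscale (c * d) v"
  by (auto simp: fscale_def)

lemma fscale_add: "fscale c (v + w) = fscale c v + fscale c w"
  "fscale (c + d) v = fscale c v + fscale d v"
  by (auto simp: fscale_def algebra_simps)

lemma fscale_basis_elt_eq [simp]: "fscale c (basis_elt f) = fscale d (basis_elt f) \<longleftrightarrow> c = d"
  by (auto simp: fscale_def basis_elt_def fun_eq_iff)

lemma fscale_basis_elt_zero [simp]: "fscale c (basis_elt f) = 0 \<longleftrightarrow> c = 0"
  using fscale_basis_elt_eq[of c f 0] by simp

lemma fscale_basis_elt_apply: "fscale c (basis_elt f) x = (if x = f then c else 0)"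
  by (simp add: fscale_def basis_elt_def)

lemma twisted_group_alg_simps [simp]:
  "gscale (twisted_group_alg G F \<gamma> \<epsilon>) = fscale"
  "aone (twisted_group_alg G F \<gamma> \<epsilon>) = basis_elt \<one>\<^bsub>G\<^esub>"
  "gcomp (twisted_group_alg G F \<gamma> \<epsilon>) f = (if f \<in> F then range (\<lambda>c. fscale c (basis_elt f)) else {0})"
  by (simp_all add: twisted_group_alg_def)

lemma twisted_group_alg_mult_zero [simp]:
  "amult (twisted_group_alg G F \<gamma> \<epsilon>) 0 v = 0" "amult (twisted_group_alg G F \<gamma> \<epsilon>) v 0 = 0"
  by (simp_all add: twisted_group_alg_def)

lemma twisted_group_alg_act_zero [simp]: "gact (twisted_group_alg G F \<gamma> \<epsilon>) h 0 = 0"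
  by (simp add: twisted_group_alg_def)

lemma twisted_group_alg_mult_basis:
  assumes "finite F" "f \<in> F" "g \<in> F"
  shows "amult (twisted_group_alg G F \<gamma> \<epsilon>) (fscale c (basis_elt f)) (fscale d (basis_elt g))
    = fscale (c * d * \<gamma> f g) (basis_elt (f \<otimes>\<^bsub>G\<^esub> g))"
proof -
  have "(\<Sum>g'\<in>F. fscale (fscale c (basis_elt f) f' * fscale d (basis_elt g) g' * \<gamma> f' g')
        (basis_elt (f' \<otimes>\<^bsub>G\<^esub> g')))
      = (if f' = f then fscale (c * d * \<gamma> f g) (basis_elt (f \<otimes>\<^bsub>G\<^esub> g)) else 0)" for f'
  proof -
    have "(\<Sum>g'\<in>F. fscale (fscale c (basis_elt f) f' * fscale d (basis_elt g) g' * \<gamma> f' g')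
        (basis_elt (f' \<otimes>\<^bsub>G\<^esub> g')))
      = (\<Sum>g'\<in>F. if g' = g then
          (if f' = f then fscale (c * d * \<gamma> f g) (basis_elt (f \<otimes>\<^bsub>G\<^esub> g)) else 0) else 0)"
      by (rule sum.cong[OF refl]) (simp add: fscale_basis_elt_apply)
    then show ?thesis using assms by (simp add: sum.delta)
  qed
  then show ?thesis using assms by (simp add: twisted_group_alg_def sum.delta)
qed

lemma twisted_group_alg_act_basis:
  assumes "finite F" "f \<in> F"
  shows "gact (twisted_group_alg G F \<gamma> \<epsilon>) h (fscale c (basis_elt f))
    = fscale (c * \<epsilon> h f) (basis_elt (conjg G h f))"
proof -
  have "(\<Sum>f'\<in>F. fscale (fscale c (basis_elt f) f' * \<epsilon> h f') (basis_elt (conjg G h f')))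
      = (\<Sum>f'\<in>F. if f' = f then fscale (c * \<epsilon> h f) (basis_elt (conjg G h f)) else 0)"
    by (rule sum.cong[OF refl]) (simp add: fscale_basis_elt_apply)
  then show ?thesis using assms by (simp add: twisted_group_alg_def sum.delta)
qed

context etale_corner begin

section \<open>Coordinates in the model and the local values of an element\<close>

abbreviation K where "K \<equiv> twisted_group_alg G F gam eps"
abbreviation M where "M \<equiv> etale_model G \<alpha> H F gam eps"

lemma M_simps:
  "gscale M = (\<lambda>c a f x. fscale c (a f x))"
  "gcomp M f = (if f \<in> carrier G
     then {a. a f \<in> ind_comp G \<alpha> H K f \<and> (\<forall>f'. f' \<noteq> f \<longrightarrow> a f' = 0)} else {0})"
  "gact M g a = (\<lambda>f' x. if f' \<in> carrier G \<and> x \<in> carrier G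
     then fscale (inverse (cocycle_act G \<alpha> (inv x) g (cj (inv g) f'))) (a (cj (inv g) f') (inv g \<otimes> x))
     else 0)"
  "amult M a b = (\<lambda>k x. if x \<in> carrier G
     then (\<Sum>(f, g) | f \<in> carrier G \<and> g \<in> carrier G \<and> f \<otimes> g = k.
        fscale (cocycle_tensor G \<alpha> (inv x) f g) (amult K (a f x) (b g x)))
     else 0)"
  "aone M = (\<lambda>f x. if f = \<one> \<and> x \<in> carrier G then basis_elt \<one> else 0)"
  by (simp_all add: etale_model_def ind_alg_def ind_rep_def graded_rep.extend_def
      graded_alg.fields_def Let_def fun_eq_iff)

lemma vector_space_M: "vector_space (gscale M)"
  unfolding M_simps by unfold_locales (auto simp: fun_eq_iff fscale_def algebra_simps)

text \<open>The isomorphism of the corner with \<open>K\<close>, one degree \<open>d\<close> at a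
  time. Off \<open>F\<close> it is set to 0, as \<open>crd\<close> has no meaning there and
  \<open>E d\<close> is zero.\<close>

definition T :: "'g \<Rightarrow> 'v \<Rightarrow> 'g \<Rightarrow> 'k" where
  "T d w = (if d \<in> F then fscale (crd d w) (basis_elt d) else 0)"

lemma T_bas: "d \<in> F \<Longrightarrow> T d (c \<cdot> bas d) = fscale c (basis_elt d)"
  by (simp add: T_def)

lemma E_cases:
  assumes "w \<in> E d"
  obtains c where "d \<in> F" "w = c \<cdot> bas d" | "d \<notin> F" "w = 0"
  using assms crd_eq E_outside_F by metis

lemma T_0 [simp]: "T d 0 = 0"
  using crd_scale[of d 0] by (simp add: T_def)

lemma T_add: "v \<in> E d \<Longrightarrow> w \<in> E d \<Longrightarrow> T d (v + w) = T d v + T d w"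
  by (elim E_cases) (simp_all add: T_bas fscale_add flip: vs.scale_left_distrib)

lemma T_scale: "w \<in> E d \<Longrightarrow> T d (c \<cdot> w) = fscale c (T d w)"
  by (elim E_cases) (simp_all add: T_bas)

lemma T_sum: "finite I \<Longrightarrow> (\<And>i. i \<in> I \<Longrightarrow> w i \<in> E d) \<Longrightarrow> T d (sum w I) = (\<Sum>i\<in>I. T d (w i))"
  by (induction I rule: finite_induct) (simp_all add: T_add vs.subspace_sum[OF E_subspace])

lemma T_inj: "v \<in> E d \<Longrightarrow> w \<in> E d \<Longrightarrow> T d v = T d w \<Longrightarrow> v = w"
  by (elim E_cases) (simp_all add: T_bas)

lemma T_in: "w \<in> E d \<Longrightarrow> T d w \<in> gcomp K d"
  by (simp add: T_def)

lemma T_onto: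
  assumes "v \<in> gcomp K d"
  shows "\<exists>w\<in>E d. T d w = v"
proof (cases "d \<in> F")
  case True
  then obtain c where "v = fscale c (basis_elt d)" using assms by auto
  then show ?thesis
    using True T_bas vs.subspace_scale[OF E_subspace bas(1)[OF True]] by blast
next
  case False
  then have "v = 0" using assms by simp
  then show ?thesis using E_0 T_0 by blast
qed

lemma T_mul:
  assumes "v \<in> E f" "w \<in> E g"
  shows "T (f \<otimes> g) (v \<star> w) = amult K (T f v) (T g w)"
proof (cases "f \<in> F \<and> g \<in> F")
  case True
  then obtain c d where "v = c \<cdot> bas f" "w = d \<cdot> bas g" using crd_eq assms by metis
  then show ?thesis
    using True bas_V F_mult
    by (simp add: gam_eq T_bas twisted_group_alg_mult_basis[OF F_finite])
next
  case False
  then have "v = 0 \<or> w = 0" using E_outside_F assms by blast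
  then show ?thesis using ED(2) assms by auto
qed

lemma T_act:
  assumes "h \<in> H" "w \<in> E f"
  shows "T (cj h f) (h \<triangleright> w) = gact K h (T f w)"
  using assms(2)
proof (cases rule: E_cases)
  case (1 c)
  then show ?thesis
    using assms(1) bas_V F_conj H_carrier
    by (simp add: eps_eq act_scale T_bas twisted_group_alg_act_basis[OF F_finite])
next
  case 2
  then show ?thesis using assms(1) H_carrier by simp
qed

text \<open>\<open>e\<close> is central, idempotent and associates strictly, so cutting down to the
  corner is multiplicative although \<open>A\<close> is not associative.\<close>

lemma e_mul:
  assumes "x \<in> V" "y \<in> V"
  shows "e \<star> (x \<star> y) = (e \<star> x) \<star> (e \<star> y)"
proof -
  have "(e \<star> x) \<star> (e \<star> y) = ((e \<star> x) \<star> e) \<star> y"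
    using assoc_one(2)[OF e(3), of "e \<star> x" y] assms e(4) by simp
  also have "(e \<star> x) \<star> e = e \<star> x"
    using comm_one[OF e(3), of "e \<star> x"] assoc_one(1)[OF e(3,4) assms(1)] assms e(4,5) by simp
  also have "(e \<star> x) \<star> y = e \<star> (x \<star> y)"
    using assoc_one(1)[OF e(3) assms] by simp
  finally show ?thesis by simp
qed

text \<open>The value at \<open>x\<close> of the element of \<open>E(e A)\<close> that corresponds to \<open>a\<close>.\<close>

definition loc :: "'g \<Rightarrow> 'v \<Rightarrow> 'v" where
  "loc x a = e \<star> (inv x \<triangleright> a)"

lemma loc_in: "x \<in> carrier G \<Longrightarrow> f \<in> carrier G \<Longrightarrow> a \<in> C f \<Longrightarrow> loc x a \<in> E (cj (inv x) f)"
  unfolding loc_def by (intro E_mul_e act_comp) auto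

lemma loc_add: "x \<in> carrier G \<Longrightarrow> a \<in> V \<Longrightarrow> b \<in> V \<Longrightarrow> loc x (a + b) = loc x a + loc x b"
  by (simp add: loc_def act_add mul_add_right e(4))

lemma loc_scale: "x \<in> carrier G \<Longrightarrow> a \<in> V \<Longrightarrow> loc x (c \<cdot> a) = c \<cdot> loc x a"
  by (simp add: loc_def act_scale e(4))

lemma loc_0 [simp]: "x \<in> carrier G \<Longrightarrow> loc x 0 = 0"
  by (simp add: loc_def e(4))

lemma loc_sum:
  "finite I \<Longrightarrow> (\<And>i. i \<in> I \<Longrightarrow> w i \<in> V) \<Longrightarrow> x \<in> carrier G \<Longrightarrow> loc x (sum w I) = (\<Sum>i\<in>I. loc x (w i))"
  by (simp add: loc_def act_sum mul_sum_right e(4))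

text \<open>This and the next two lemmas account for the scalars in E(V): they arise from acting by
  x^-1 on a product, from acting by x^-1 after g, and from acting by h^-1 after x^-1.\<close>

lemma loc_mul:
  assumes "x \<in> carrier G" "f \<in> carrier G" "g \<in> carrier G" "a \<in> C f" "b \<in> C g"
  shows "loc x (a \<star> b) = cocycle_tensor G \<alpha> (inv x) f g \<cdot> (loc x a \<star> loc x b)"
proof -
  have "a \<in> V" "b \<in> V" using assms comp_V by blast+
  then show ?thesis
    using act_mul[of "inv x" f g a b] assms e(4) by (simp add: loc_def e_mul)
qed

lemma loc_act:
  assumes "x \<in> carrier G" "g \<in> carrier G" "f \<in> carrier G" "a \<in> C f"
  shows "loc x (g \<triangleright> a) = inverse (cocycle_act G \<alpha> (inv x) g f) \<cdot> loc (inv g \<otimes> x) a"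
proof -
  have "a \<in> V" using assms comp_V by blast
  moreover have "cocycle_act G \<alpha> (inv x) g f \<noteq> 0" using assms by (simp add: cocycle_act_nz)
  ultimately show ?thesis
    using act_mult[of "inv x" g f a] assms e(4) by (simp add: loc_def inv_mult_group)
qed

lemma loc_right_coset:
  assumes "x \<in> carrier G" "h \<in> H" "f \<in> carrier G" "a \<in> C f"
  shows "loc (x \<otimes> h) a = cocycle_act G \<alpha> (inv h) (inv x) f \<cdot> (inv h \<triangleright> loc x a)"
proof -
  have a: "a \<in> V" using assms comp_V by blast
  have h: "h \<in> carrier G" "inv h \<in> H" "inv h \<triangleright> e = e"
    using assms(2) subgroup.m_inv_closed[OF H_subgroup] by (auto simp: H_def)
  \<comment> \<open>Membership in \<open>H\<close> is what counts here: h^-1 fixes \<open>e\<close>,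
    so acting by it commutes with multiplication by \<open>e\<close>.\<close>
  have "inv h \<triangleright> loc x a = e \<star> (inv h \<triangleright> (inv x \<triangleright> a))"
    using act_mul_one[of "inv h" e "inv x \<triangleright> a"] h a assms e(3) by (simp add: loc_def)
  then show ?thesis
    using act_mult[of "inv h" "inv x" f a] h assms a e(4) by (simp add: loc_def inv_mult_group)
qed

lemma loc_unit: "x \<in> carrier G \<Longrightarrow> loc x U = e"
  by (simp add: loc_def act_U e(4))

text \<open>The projections are needed because the degree of the local value at \<open>x\<close>,
  and with it the map \<open>T\<close>, depends on the degree \<open>f\<close> of the part
  considered. The value 0 off the carrier matches the model.\<close>

definition \<phi> :: "'v \<Rightarrow> 'g \<Rightarrow> 'g \<Rightarrow> 'g \<Rightarrow> 'k" where
  "\<phi> a = (\<lambda>f x. if f \<in> carrier G \<and> x \<in> carrier G then T (cj (inv x) f) (loc x (pr f a)) else 0)"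

lemma loc_pr: "a \<in> V \<Longrightarrow> x \<in> carrier G \<Longrightarrow> f \<in> carrier G \<Longrightarrow> loc x (pr f a) \<in> E (cj (inv x) f)"
  using loc_in pr_in by blast

lemma phi_add: "a \<in> V \<Longrightarrow> b \<in> V \<Longrightarrow> \<phi> (a + b) = \<phi> a + \<phi> b"
  by (auto simp: \<phi>_def fun_eq_iff pr_add loc_add pr_V T_add loc_pr)

lemma phi_scale: "a \<in> V \<Longrightarrow> \<phi> (c \<cdot> a) = gscale M c (\<phi> a)"
  by (auto simp: \<phi>_def fun_eq_iff pr_scale loc_scale pr_V T_scale loc_pr M_simps)

lemma phi_unit: "\<phi> U = aone M"
proof -
  have "T \<one> e = basis_elt \<one>" using T_bas[of \<one> 1] F_one by simp
  then show ?thesis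
    by (auto simp: \<phi>_def fun_eq_iff M_simps pr_comp[OF U_comp] loc_unit)
qed

lemma pr_act:
  assumes "a \<in> V" "g \<in> carrier G" "f \<in> carrier G"
  shows "pr f (g \<triangleright> a) = g \<triangleright> pr (cj (inv g) f) a"
proof (rule pr_eq)
  show "g \<triangleright> pr (cj (inv g) f') a \<in> C f'" if "f' \<in> carrier G" for f'
    using act_comp[OF assms(2) _ pr_in[OF assms(1)], of "cj (inv g) f'"] assms that
    by (simp add: cj_inv)
  have "g \<triangleright> a = (\<Sum>k\<in>carrier G. g \<triangleright> pr k a)"
    using act_sum[OF fin, of "\<lambda>k. pr k a" g] assms pr_V sum_pr by simp
  also have "\<dots> = (\<Sum>f'\<in>carrier G. g \<triangleright> pr (cj (inv g) f') a)"
    using assms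
    by (intro sum.reindex_bij_witness[of _ "cj (inv g)" "cj g"]) (auto simp: cj_inv)
  finally show "g \<triangleright> a = (\<Sum>f'\<in>carrier G. g \<triangleright> pr (cj (inv g) f') a)" .
qed (use assms in auto)

lemma phi_act:
  assumes "a \<in> V" "g \<in> carrier G"
  shows "\<phi> (g \<triangleright> a) = gact M g (\<phi> a)"
proof (intro ext)
  fix f x y
  show "\<phi> (g \<triangleright> a) f x y = gact M g (\<phi> a) f x y"
  proof (cases "f \<in> carrier G \<and> x \<in> carrier G")
    case True
    let ?k = "cj (inv g) f"
    have k: "?k \<in> carrier G" "inv g \<otimes> x \<in> carrier G" using True assms by auto
    \<comment> \<open>The degrees on both sides agree, so the same \<open>T\<close> is applied on
      both sides.\<close>
    have "cj (inv (inv g \<otimes> x)) ?k = cj (inv x) f"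
      using True assms by (simp add: inv_mult_group cj_mult cj_inv)
    moreover have "loc x (g \<triangleright> pr ?k a)
        = inverse (cocycle_act G \<alpha> (inv x) g ?k) \<cdot> loc (inv g \<otimes> x) (pr ?k a)"
      using True assms k pr_in by (intro loc_act) auto
    ultimately show ?thesis
      using True assms k loc_pr[OF assms(1) k(2,1)] by (simp add: \<phi>_def M_simps pr_act T_scale)
  qed (auto simp: \<phi>_def M_simps)
qed

lemma pr_mul:
  assumes "a \<in> V" "b \<in> V" "k \<in> carrier G"
  shows "pr k (a \<star> b) = (\<Sum>(f, g) | f \<in> carrier G \<and> g \<in> carrier G \<and> f \<otimes> g = k. pr f a \<star> pr g b)"
proof (rule pr_eq)
  let ?c = "\<lambda>k. \<Sum>(f, g) | f \<in> carrier G \<and> g \<in> carrier G \<and> f \<otimes> g = k. pr f a \<star> pr g b"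
  show "?c k \<in> C k" if "k \<in> carrier G" for k
    using mul_comp[OF pr_in[OF assms(1)] pr_in[OF assms(2)]] by (intro comp_sum) auto
  have "a \<star> b = (\<Sum>f\<in>carrier G. pr f a) \<star> (\<Sum>g\<in>carrier G. pr g b)"
    using assms sum_pr by simp
  also have "\<dots> = (\<Sum>f\<in>carrier G. \<Sum>g\<in>carrier G. pr f a \<star> pr g b)"
    using fin pr_V assms by (subst mul_sum_left) (auto simp: V_sum mul_sum_right)
  also have "\<dots> = (\<Sum>(f, g)\<in>carrier G \<times> carrier G. pr f a \<star> pr g b)"
    by (rule sum.cartesian_product)
  also have "\<dots> = (\<Sum>k\<in>carrier G. \<Sum>p | p \<in> carrier G \<times> carrier G \<and> (\<lambda>(f, g). f \<otimes> g) p = k.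
      (\<lambda>(f, g). pr f a \<star> pr g b) p)"
    using fin by (intro sum.group[symmetric]) auto
  also have "\<dots> = (\<Sum>k\<in>carrier G. ?c k)"
    by (intro sum.cong refl) auto
  finally show "a \<star> b = (\<Sum>k\<in>carrier G. ?c k)" .
qed (use assms in auto)

lemma phi_mul:
  assumes "a \<in> V" "b \<in> V"
  shows "\<phi> (a \<star> b) = amult M (\<phi> a) (\<phi> b)"
proof (rule ext, rule ext)
  fix k x
  let ?S = "{(f, g). f \<in> carrier G \<and> g \<in> carrier G \<and> f \<otimes> g = k}"
  have finS: "finite ?S" by (rule finite_subset[of _ "carrier G \<times> carrier G"]) (use fin in auto)
  show "\<phi> (a \<star> b) k x = amult M (\<phi> a) (\<phi> b) k x"
  proof (cases "k \<in> carrier G \<and> x \<in> carrier G")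
    case True
    have summand: "loc x (pr f a \<star> pr g b) \<in> E (cj (inv x) k) \<and>
        T (cj (inv x) k) (loc x (pr f a \<star> pr g b))
        = fscale (cocycle_tensor G \<alpha> (inv x) f g) (amult K (\<phi> a f x) (\<phi> b g x))"
      if "(f, g) \<in> ?S" for f g
    proof -
      have fg: "f \<in> carrier G" "g \<in> carrier G" "f \<otimes> g = k" using that by auto
      have cjk: "cj (inv x) f \<otimes> cj (inv x) g = cj (inv x) k"
        using fg True by (simp add: conjg_def m_assoc flip: fg(3)) (simp flip: m_assoc)
      have la: "loc x (pr f a) \<in> E (cj (inv x) f)" and lb: "loc x (pr g b) \<in> E (cj (inv x) g)"
        using loc_pr assms fg True by auto
      note lab = E_mul[OF la lb, unfolded cjk]
      have "loc x (pr f a \<star> pr g b)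
          = cocycle_tensor G \<alpha> (inv x) f g \<cdot> (loc x (pr f a) \<star> loc x (pr g b))"
        using loc_mul fg True assms pr_in by blast
      then show ?thesis
        using T_scale[OF lab] T_mul[OF la lb, unfolded cjk] vs.subspace_scale[OF E_subspace lab] fg True
        by (simp add: \<phi>_def)
    qed
    have "loc x (pr k (a \<star> b)) = (\<Sum>(f, g)\<in>?S. loc x (pr f a \<star> pr g b))"
      unfolding pr_mul[OF assms conjunct1[OF True]]
      using loc_sum[OF finS, of "\<lambda>(f, g). pr f a \<star> pr g b" x] pr_V assms True
      by (auto simp: case_prod_unfold)
    then have "\<phi> (a \<star> b) k x = T (cj (inv x) k) (\<Sum>(f, g)\<in>?S. loc x (pr f a \<star> pr g b))"
      using True by (simp add: \<phi>_def)
    also have "\<dots> = (\<Sum>p\<in>?S. T (cj (inv x) k) ((\<lambda>(f, g). loc x (pr f a \<star> pr g b)) p))"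
      using summand by (intro T_sum[OF finS]) auto
    also have "\<dots> = (\<Sum>(f, g)\<in>?S. fscale (cocycle_tensor G \<alpha> (inv x) f g) (amult K (\<phi> a f x) (\<phi> b g x)))"
      using summand by (intro sum.cong refl) auto
    finally show ?thesis using True by (simp add: M_simps)
  next
    case False
    \<comment> \<open>For \<open>k\<close> off the carrier the sum in the model is empty, since the
      carrier is closed under products.\<close>
    then consider "x \<notin> carrier G" | "x \<in> carrier G" "k \<notin> carrier G" "?S = {}" by auto
    then show ?thesis by cases (simp_all only: \<phi>_def M_simps, simp_all)
  qed
qed

lemma phi_inj:
  assumes a: "a \<in> V" and 0: "\<phi> a = 0"
  shows "a = 0"
proof -
  have "pr f a = 0" if f: "f \<in> carrier G" for f
  proof -
    note pV = pr_V[OF a f]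
    have "q \<star> pr f a = 0" if q: "q \<in> orb" for q
    proof -
      obtain x where x: "x \<in> carrier G" "q = x \<triangleright> e" using q by (auto simp: orb_def)
      have "T (cj (inv x) f) (loc x (pr f a)) = 0"
        using fun_cong[OF fun_cong[OF 0], of f x] f x by (simp add: \<phi>_def)
      then have "loc x (pr f a) = 0" using T_inj[OF loc_pr[OF a x(1) f] E_0] by simp
      \<comment> \<open>As x^-1.q = e, the left side is the local value at \<open>x\<close>; so each
        conjugate of \<open>e\<close> annihilates the part of degree \<open>f\<close>.\<close>
      then have "inv x \<triangleright> (q \<star> pr f a) = 0"
        using act_mul_one[of "inv x" q "pr f a"] orb_V[OF q] x pV act_inv_cancel(2)[OF x(1) e(3)]
        by (simp add: loc_def)
      then show ?thesis
        using act_inj[of "inv x" "q \<star> pr f a" 0] x orb_V[OF q] pV by simp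
    qed
    then have "\<Sum>orb \<star> pr f a = 0"
      using mul_sum_left[OF orb_finite, of "\<lambda>q. q" "pr f a"] orb_V pV by simp
    then show ?thesis using sum_orb pV by simp
  qed
  then show ?thesis using sum_pr[OF a] by simp
qed

lemma phi_comp_into:
  assumes f: "f \<in> carrier G" and a: "a \<in> C f"
  shows "\<phi> a \<in> gcomp M f"
proof -
  have other: "\<phi> a f' = 0" if "f' \<noteq> f" for f'
    using that pr_comp[OF a] by (auto simp: \<phi>_def fun_eq_iff)
  have val: "\<phi> a f x = T (cj (inv x) f) (loc x a)" if "x \<in> carrier G" for x
    using that f pr_comp[OF a f] by (simp add: \<phi>_def)
  have "\<phi> a f \<in> ind_comp G \<alpha> H K f"
    unfolding ind_comp_def mem_Collect_eq
  proof (intro conjI ballI allI impI)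
    show "\<phi> a f x \<in> gcomp K (inv x \<otimes> f \<otimes> x)" if "x \<in> carrier G" for x
      using T_in[OF loc_in[OF that f a]] val[OF that] cj_inv_eq[OF that, of f] by simp
    show "\<phi> a f x = 0" if "x \<notin> carrier G" for x using that by (simp add: \<phi>_def)
    fix x h assume x: "x \<in> carrier G" and h: "h \<in> H"
    note hc = H_carrier[OF h]
    have hi: "inv h \<in> H" using h subgroup.m_inv_closed[OF H_subgroup] by blast
    note l = loc_in[OF x f a]
    have "\<phi> a f (x \<otimes> h) = T (cj (inv h) (cj (inv x) f)) (loc (x \<otimes> h) a)"
      using val[of "x \<otimes> h"] x hc f by (simp add: inv_mult_group cj_mult)
    also have "\<dots> = fscale (cocycle_act G \<alpha> (inv h) (inv x) f) (gact K (inv h) (\<phi> a f x))"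
      using loc_right_coset[OF x h f a] T_act[OF hi l] T_scale[OF E_act[OF hi l]] val[OF x] f x by simp
    finally show "\<phi> a f (x \<otimes> h)
        = gscale K (cocycle_act G \<alpha> (inv h) (inv x) f) (gact K (inv h) (\<phi> a f x))" by simp
  qed
  then show ?thesis using other f by (simp add: M_simps)
qed

text \<open>Each value of \<open>m\<close> has a local preimage \<open>u x\<close> in
  \<open>C f\<close>; the equivariance of \<open>m\<close> makes \<open>u\<close> depend only on the
  conjugate x.e, so one local preimage per element of \<open>orb\<close> can be glued.\<close>

lemma phi_comp_onto:
  assumes f: "f \<in> carrier G" and m: "m \<in> gcomp M f"
  shows "m \<in> \<phi> ` C f"
proof -
  define a where "a = m f"
  have ind: "a \<in> ind_comp G \<alpha> H K f" and other: "\<And>f'. f' \<noteq> f \<Longrightarrow> m f' = 0"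
    using m f by (auto simp: M_simps a_def)
  have "\<exists>u\<in>C f. inv x \<triangleright> u \<in> E (cj (inv x) f) \<and> T (cj (inv x) f) (inv x \<triangleright> u) = a x"
    if x: "x \<in> carrier G" for x
  proof -
    have "a x \<in> gcomp K (cj (inv x) f)"
      using ind x unfolding ind_comp_def cj_inv_eq[OF x] by blast
    then obtain w where w: "w \<in> E (cj (inv x) f)" "T (cj (inv x) f) w = a x" using T_onto by blast
    then obtain u where "u \<in> C f" "w = inv x \<triangleright> u"
      using ED(1)[OF w(1)] act_image[of "inv x" f] x f by auto
    then show ?thesis using w by blast
  qed
  (* Choosing u x with x^-1.u x = a x, instead of u x = x.(a x), makes u constant on the cosets of H
     with no scalars to compare. *)
  then obtain u where u: "\<And>x. x \<in> carrier G \<Longrightarrow> u x \<in> C f"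
    and w: "\<And>x. x \<in> carrier G \<Longrightarrow> inv x \<triangleright> u x \<in> E (cj (inv x) f)"
    and Tw: "\<And>x. x \<in> carrier G \<Longrightarrow> T (cj (inv x) f) (inv x \<triangleright> u x) = a x"
    by metis
  have lu: "loc x (u x) = inv x \<triangleright> u x" if "x \<in> carrier G" for x
    unfolding loc_def using ED(3)[OF w[OF that]] .
  have coset: "u (x \<otimes> h) = u x" if x: "x \<in> carrier G" and h: "h \<in> H" for x h
  proof -
    note hc = H_carrier[OF h]
    have hi: "inv h \<in> H" using h subgroup.m_inv_closed[OF H_subgroup] by blast
    have xh: "x \<otimes> h \<in> carrier G" using x hc by simp
    let ?c = "cocycle_act G \<alpha> (inv h) (inv x) f"
    let ?d = "cj (inv h) (cj (inv x) f)"
    have d: "cj (inv (x \<otimes> h)) f = ?d" using x hc f by (simp add: inv_mult_group cj_mult)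
    have in_d: "inv h \<triangleright> (inv x \<triangleright> u x) \<in> E ?d" using E_act[OF hi w[OF x]] x f by simp
    have "T ?d (inv (x \<otimes> h) \<triangleright> u (x \<otimes> h)) = a (x \<otimes> h)" using Tw[OF xh] d by simp
    also have "\<dots> = fscale ?c (gact K (inv h) (a x))"
      using ind x h unfolding ind_comp_def by simp
    also have "\<dots> = T ?d (?c \<cdot> (inv h \<triangleright> (inv x \<triangleright> u x)))"
      using T_act[OF hi w[OF x]] T_scale[OF in_d] Tw[OF x] by simp
    finally have "inv (x \<otimes> h) \<triangleright> u (x \<otimes> h) = ?c \<cdot> (inv h \<triangleright> (inv x \<triangleright> u x))"
      using T_inj w[OF xh] d vs.subspace_scale[OF E_subspace in_d] by metis
    also have "\<dots> = inv (x \<otimes> h) \<triangleright> u x"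
      using act_mult[of "inv h" "inv x" f "u x"] u[OF x] hc x f by (simp add: inv_mult_group)
    finally show ?thesis
      using act_inj[of "inv (x \<otimes> h)"] xh comp_V[OF u] x by simp
  qed
  have "\<forall>q\<in>orb. \<exists>x. x \<in> carrier G \<and> x \<triangleright> e = q" by (auto simp: orb_def)
  then obtain r where r: "\<And>q. q \<in> orb \<Longrightarrow> r q \<in> carrier G" "\<And>q. q \<in> orb \<Longrightarrow> r q \<triangleright> e = q" by metis
  \<comment> \<open>Orthogonal idempotents act as a partition of unity: the factor \<open>q\<close>
    restricts the local preimage to the coset where it is valid.\<close>
  define v where "v = (\<Sum>q\<in>orb. q \<star> u (r q))"
  have qu: "q \<star> u (r q) \<in> C f" if "q \<in> orb" for q
    using mul_comp_one(1) orb_V(2)[OF that] u r that by blast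
  have v: "v \<in> C f" unfolding v_def using qu by (intro comp_sum)
  have "loc y v = loc y (u y)" if y: "y \<in> carrier G" for y
  proof -
    let ?p = "y \<triangleright> e"
    have p: "?p \<in> orb" using y by (simp add: orb_def)
    have "loc y (q \<star> u (r q)) = (if q = ?p then loc y (u (r q)) else 0)" if q: "q \<in> orb" for q
    proof -
      note uV = comp_V[OF u[OF r(1)[OF q]]]
      have iq: "inv y \<triangleright> q \<in> orb" "inv y \<triangleright> q \<in> V" using act_orb[OF _ q] orb_V y by auto
      have "loc y (q \<star> u (r q)) = (e \<star> (inv y \<triangleright> q)) \<star> (inv y \<triangleright> u (r q))"
        using act_mul_one[of "inv y" q "u (r q)"] orb_V[OF q] uV y iq e(3)
        by (simp add: loc_def assoc_one(1))
      \<comment> \<open>By orthogonality, after moving by y^-1 only the summand for the conjugate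
        y.e survives multiplication by \<open>e\<close>.\<close>
      moreover have "e = inv y \<triangleright> q \<longleftrightarrow> q = ?p"
        using act_inv_cancel[OF y e(3)] act_inv_cancel[OF y orb_V(2)[OF q]] by metis
      ultimately show ?thesis
        using orb_mul[OF e_orb iq(1)] uV y by (simp add: loc_def)
    qed
    then have "loc y v = (\<Sum>q\<in>orb. if q = ?p then loc y (u (r q)) else 0)"
      unfolding v_def using loc_sum[OF orb_finite _ y, of "\<lambda>q. q \<star> u (r q)"] comp_V[OF qu] by simp
    also have "\<dots> = loc y (u (r ?p))" using p orb_finite by (simp add: sum.delta)
    \<comment> \<open>The representative \<open>r ?p\<close> and \<open>y\<close> move
      \<open>e\<close> to the same conjugate, so they differ by an element of \<open>H\<close> on
      the right.\<close>
    also have "u (r ?p) = u y"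
    proof -
      note rp = r[OF p]
      have "(inv (r ?p) \<otimes> y) \<triangleright> e = e"
        using act_mult_one[of "inv (r ?p)" y e] act_inv_cancel(2)[OF rp(1) e(3)] rp y e(3) by simp
      then have "inv (r ?p) \<otimes> y \<in> H" using rp y by (simp add: H_def)
      from coset[OF rp(1) this] show ?thesis using rp y by (simp flip: m_assoc)
    qed
    finally show ?thesis .
  qed
  then have "\<phi> v f x = a x" if "x \<in> carrier G" for x
    using that f pr_comp[OF v f] lu Tw by (simp add: \<phi>_def)
  moreover have "a x = 0" if "x \<notin> carrier G" for x
    using ind that by (simp add: ind_comp_def)
  ultimately have "\<phi> v f = m f" using f by (auto simp: a_def \<phi>_def fun_eq_iff)
  moreover have "\<phi> v f' = m f'" if "f' \<noteq> f" for f'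
    using that pr_comp[OF v] other[OF that] by (auto simp: \<phi>_def fun_eq_iff)
  ultimately have "\<phi> v = m" by (metis ext)
  then show ?thesis using v by blast
qed

lemma phi_comp: "\<phi> ` C f = gcomp M f"
proof (cases "f \<in> carrier G")
  case True
  then show ?thesis using phi_comp_into phi_comp_onto by blast
next
  case False
  have "\<phi> 0 = 0" using phi_scale[of 0 0] by (simp add: M_simps fun_eq_iff)
  then show ?thesis using False by (simp add: comp_outside M_simps)
qed

lemma isomorphic_model: "zalg_isomorphic G A M"
  by (rule zalg_isomorphicI[OF vector_space_M phi_add phi_scale phi_comp phi_inj phi_act phi_mul phi_unit])

end

theorem theorem3p19:
  fixes G :: "('g, 'b) monoid_scheme"
    and \<alpha> :: "'g \<Rightarrow> 'g \<Rightarrow> 'g \<Rightarrow> 'k::{alg_closed_field, field_char_0}"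
    and A :: "('k, 'g, 'v::ab_group_add) graded_alg"
  assumes "group G" and "finite (carrier G)"
    and "normalised_cocycle3 G \<alpha>"
    and "etale_algebra G \<alpha> A"
  shows "\<exists>(H :: 'g set) (F :: 'g set) (\<gamma> :: 'g \<Rightarrow> 'g \<Rightarrow> 'k) (\<epsilon> :: 'g \<Rightarrow> 'g \<Rightarrow> 'k).
    subgroup H G \<and> F \<lhd> (G\<lparr>carrier := H\<rparr>) \<and>
    normalised_cochain2 G F \<gamma> \<and>
    (\<forall>f\<in>F. \<forall>g\<in>F. \<forall>h\<in>F. coboundary2 G \<gamma> f g h = \<alpha> f g h) \<and>
    (\<forall>h\<in>H. \<forall>f\<in>F. \<epsilon> h f \<noteq> 0) \<and>
    (\<forall>g\<in>H. \<forall>h\<in>H. \<forall>f\<in>F.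
       \<epsilon> (g \<otimes>\<^bsub>G\<^esub> h) f = \<epsilon> g (conjg G h f) * \<epsilon> h f * cocycle_act G \<alpha> g h f) \<and>
    (\<forall>h\<in>H. \<forall>f\<in>F. \<forall>g\<in>F.
       \<gamma> f g * \<epsilon> h (f \<otimes>\<^bsub>G\<^esub> g) =
       cocycle_tensor G \<alpha> h f g * \<epsilon> h f * \<epsilon> h g * \<gamma> (conjg G h f) (conjg G h g)) \<and>
    (\<forall>f\<in>F. \<forall>g\<in>F. \<gamma> f g = \<epsilon> f g * \<gamma> (conjg G f g) f) \<and>
    zalg_isomorphic G A (etale_model G \<alpha> H F \<gamma> \<epsilon>)"
proof -
  interpret group G by fact
  interpret etale_zalg G \<alpha> A
    by unfold_locales (use assms in \<open>auto simp: etale_algebra_def\<close>)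
  obtain e where "primitive e" using primitive_exists by blast
  then interpret etale_corner G \<alpha> A e by unfold_locales
  show ?thesis
    by (intro exI[of _ H] exI[of _ F] exI[of _ gam] exI[of _ eps] conjI ballI H_subgroup F_normal
        normalised_cochain2_gam coboundary2_gam eps_nz eps_mult gam_eps gam_comm isomorphic_model)
qed

end
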